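(* Let $\sigma$ be the admissible, complete, or stable semantics, i.e. $\sigma\in\{\mathrm{adm},\mathrm{com},\mathrm{stb}\}$, and let $c$ be a natural number. Then each of the parameterized problems $\sigma$-Small, $\sigma$-Repair, $\sigma$-Adjust, and $\sigma$-Center is fixed-parameter tractable when restricted to instances whose argumentation framework has maximum degree at most $c$.
   Context: Argumentation frameworks. An argumentation framework (AF) is a pair $F=(X,A)$ with $X$ a finite set (of arguments) and $A\subseteq X\times X$ (the attack relation; self-attacks are allowed). If $(x,y)\in A$, we say $x$ attacks $y$. The degree of $x\in X$ is the number of arguments $y\in X\setminus\{x\}$ with $(x,y)\in A$ or $(y,x)\in A$; the maximum degree of $F$ is the maximum of the degrees of its arguments. For $S\subseteq X$ and $x\in X$, $x$ is defended by $S$ if for each $x'\in X$ with $(x',x)\in A$ there is $x''\in S$ with $(x'',x')\in A$. $S$ is conflict-free if there are no $x,x'\in S$ with $(x,x')\in A$. $S^+$ denotes the set of $x\in X$ such that $x\in S$ or some $x'\in S$ satisfies $(x',x)\in A$. Semantics. For an AF $F=(X,A)$ and conflict-free $S\subseteq X$ (only conflict-free sets can be extensions): $S\in\mathrm{adm}(F)$ (admissible) iff each $s\in S$ is defended by $S$; $S\in\mathrm{com}(F)$ (complete) iff $S\in\mathrm{adm}(F)$ and every argument defended by $S$ is in $S$; $S\in\mathrm{stb}(F)$ (stable) iff $S^+=X$. The members of $\sigma(F)$ are called ($\sigma$-)extensions. For sets of arguments $E,E'$, $E\bigtriangleup E'$ is the symmetric difference and $\mathrm{dist}(E,E')=|E\bigtriangleup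 E'|$. Problems (for a semantics $\sigma$): - $\sigma$-Small. Instance: an AF $F=(X,A)$ and a nonnegative integer $k$. Parameter: $k$. Question: is there a nonempty $E\in\sigma(F)$ with $|E|\le k$? - $\sigma$-Repair. Instance: an AF $F=(X,A)$, a set $S\subseteq X$, a nonnegative integer $k$. Parameter: $k$. Question: is there a nonempty $E\in\sigma(F)$ with $\mathrm{dist}(E,S)\le k$? - $\sigma$-Adjust. Instance: an AF $F=(X,A)$, an extension $E_0\in\sigma(F)$, an argument $t\in X$, a nonnegative integer $k$. Parameter: $k$. Question: is there $E\in\sigma(F)$ with $\mathrm{dist}(E,E_0)\le k$ and $t\in E_0\bigtriangleup E$? - $\sigma$-Center. Instance: an AF $F=(X,A)$ and two extensions $E_1,E_2\in\sigma(F)$. Parameter: $\mathrm{dist}(E_1,E_2)$. Question: is there $E\in\sigma(F)$ with $\mathrm{dist}(E,E_i)<\mathrm{dist}(E_1,E_2)$ for every $i\in\{1,2\}$? A parameterized problem is fixed-parameter tractable if there is a computable function $f$ such that instances of size $n$ with parameter $k$ can be solved in time $f(k)\cdot n^{O(1)}$ (the exponent being independent of $k$). *)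

theory Defs
  imports Main
begin

section \<open>Argumentation frameworks\<close>

type_synonym 'a af = "'a set \<times> ('a \<times> 'a) set"

definition is_af :: "'a af \<Rightarrow> bool" where
  "is_af F \<longleftrightarrow> (case F of (X, A) \<Rightarrow> finite X \<and> A \<subseteq> X \<times> X)"

definition degree :: "'a af \<Rightarrow> 'a \<Rightarrow> nat" where
  "degree F x = (case F of (X, A) \<Rightarrow> card {y \<in> X - {x}. (x, y) \<in> A \<or> (y, x) \<in> A})"

text \<open>The maximum degree of the framework without arguments is taken to be 0.\<close>

definition max_degree :: "'a af \<Rightarrow> nat" where
  "max_degree F = Max (insert 0 (degree F ` fst F))"

definition defended :: "'a af \<Rightarrow> 'a set \<Rightarrow> 'a \<Rightarrow> bool" where
  "defended F S x \<longleftrightarrow>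
     (case F of (X, A) \<Rightarrow> \<forall>x'\<in>X. (x', x) \<in> A \<longrightarrow> (\<exists>x''\<in>S. (x'', x') \<in> A))"

definition conflict_free :: "'a af \<Rightarrow> 'a set \<Rightarrow> bool" where
  "conflict_free F S \<longleftrightarrow>
     (case F of (X, A) \<Rightarrow> S \<subseteq> X \<and> \<not> (\<exists>x\<in>S. \<exists>x'\<in>S. (x, x') \<in> A))"

definition range_of :: "'a af \<Rightarrow> 'a set \<Rightarrow> 'a set" where
  "range_of F S = (case F of (X, A) \<Rightarrow> {x \<in> X. x \<in> S \<or> (\<exists>x'\<in>S. (x', x) \<in> A)})"

definition adm :: "'a af \<Rightarrow> 'a set set" where
  "adm F = {S. conflict_free F S \<and> (\<forall>s\<in>S. defended F S s)}"

definition com :: "'a af \<Rightarrow> 'a set set" where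
  "com F = {S \<in> adm F. \<forall>x\<in>fst F. defended F S x \<longrightarrow> x \<in> S}"

definition stb :: "'a af \<Rightarrow> 'a set set" where
  "stb F = {S. conflict_free F S \<and> range_of F S = fst F}"

definition dist :: "'a set \<Rightarrow> 'a set \<Rightarrow> nat" where
  "dist E E' = card (sym_diff E E')"

section \<open>Model of computation\<close>

text \<open>
  Jones' WHILE language over binary trees (N. D. Jones, Computability and Complexity from a
  Programming Perspective, MIT Press, 1997). With the cost measure below, in which each
  evaluation of an operator costs one unit, WHILE programs and Turing machines simulate each
  other with polynomial overhead: trees are stored as shared pointer structures, so that every
  operator takes a constant number of pointer operations. There is deliberately no test for
  equality of trees.
\<close>

datatype tree = Leaf | Node tree tree

fun tree_size :: "tree \<Rightarrow> nat" where
  "tree_size Leaf = 1"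
| "tree_size (Node l r) = 1 + tree_size l + tree_size r"

datatype expr = Var nat | ELeaf | ENode expr expr | ELeft expr | ERight expr

datatype cmd =
    Skip
  | Assign nat expr
  | Seq cmd cmd
  | Cond expr cmd cmd
  | While expr cmd

type_synonym state = "nat \<Rightarrow> tree"

fun left :: "tree \<Rightarrow> tree" where
  "left Leaf = Leaf"
| "left (Node l r) = l"

fun right :: "tree \<Rightarrow> tree" where
  "right Leaf = Leaf"
| "right (Node l r) = r"

fun eval_expr :: "expr \<Rightarrow> state \<Rightarrow> tree" where
  "eval_expr (Var x) s = s x"
| "eval_expr ELeaf s = Leaf"
| "eval_expr (ENode a b) s = Node (eval_expr a s) (eval_expr b s)"
| "eval_expr (ELeft a) s = left (eval_expr a s)"
| "eval_expr (ERight a) s = right (eval_expr a s)"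

fun cost :: "expr \<Rightarrow> nat" where
  "cost (Var x) = 1"
| "cost ELeaf = 1"
| "cost (ENode a b) = 1 + cost a + cost b"
| "cost (ELeft a) = 1 + cost a"
| "cost (ERight a) = 1 + cost a"

text \<open>
  \<open>exec p s n s'\<close>: started in state \<open>s\<close>, the program \<open>p\<close> halts after \<open>n\<close> steps in state \<open>s'\<close>.
  A condition holds iff it does not evaluate to \<open>Leaf\<close>.
\<close>

inductive exec :: "cmd \<Rightarrow> state \<Rightarrow> nat \<Rightarrow> state \<Rightarrow> bool" where
  exec_Skip: "exec Skip s 1 s"
| exec_Assign: "exec (Assign x e) s (1 + cost e) (s(x := eval_expr e s))"
| exec_Seq: "exec p s m s' \<Longrightarrow> exec q s' n s'' \<Longrightarrow> exec (Seq p q) s (1 + m + n) s''"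
| exec_Cond_true:
    "eval_expr e s \<noteq> Leaf \<Longrightarrow> exec p s n s' \<Longrightarrow> exec (Cond e p q) s (1 + cost e + n) s'"
| exec_Cond_false:
    "eval_expr e s = Leaf \<Longrightarrow> exec q s n s' \<Longrightarrow> exec (Cond e p q) s (1 + cost e + n) s'"
| exec_While_false:
    "eval_expr e s = Leaf \<Longrightarrow> exec (While e p) s (1 + cost e) s"
| exec_While_true:
    "eval_expr e s \<noteq> Leaf \<Longrightarrow> exec p s m s' \<Longrightarrow> exec (While e p) s' n s'' \<Longrightarrow>
     exec (While e p) s (1 + cost e + m + n) s''"

lemma exec_deterministic:
  "exec p s m s' \<Longrightarrow> exec p s n s'' \<Longrightarrow> m = n \<and> s' = s''"
proof (induction arbitrary: n s'' rule: exec.induct)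
  case (exec_Seq p s m s' q k t)
  from exec_Seq.prems exec_Seq.IH show ?case by (cases rule: exec.cases) blast+
next
  case (exec_While_true e s p m s' k t)
  from exec_While_true.prems exec_While_true.hyps exec_While_true.IH show ?case
    by (cases rule: exec.cases) blast+
qed (erule exec.cases; fastforce)+

text \<open>Variable 0 holds the input at the start and the output at the end of a run.\<close>

definition runs :: "cmd \<Rightarrow> tree \<Rightarrow> nat \<Rightarrow> tree \<Rightarrow> bool" where
  "runs p t n u \<longleftrightarrow> (\<exists>s. exec p ((\<lambda>_. Leaf)(0 := t)) n s \<and> s 0 = u)"

section \<open>Encodings\<close>

text \<open>An object may have several encodings; a program has to cope with each of them.\<close>

type_synonym 'a encoding = "'a \<Rightarrow> tree set"

fun list_tree :: "tree list \<Rightarrow> tree" where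
  "list_tree [] = Leaf"
| "list_tree (t # ts) = Node t (list_tree ts)"

definition bool_tree :: "bool \<Rightarrow> tree" where
  "bool_tree b = (if b then Node Leaf Leaf else Leaf)"

text \<open>Binary notation without leading zeros, least significant digit first.\<close>

fun nat_bits :: "nat \<Rightarrow> bool list" where
  "nat_bits n = (if n = 0 then [] else odd n # nat_bits (n div 2))"

declare nat_bits.simps [simp del]

definition nat_tree :: "nat \<Rightarrow> tree" where
  "nat_tree n = list_tree (map bool_tree (nat_bits n))"

definition enc_nat :: "nat encoding" where
  "enc_nat n = {nat_tree n}"

definition enc_pair :: "'a encoding \<Rightarrow> 'b encoding \<Rightarrow> ('a \<times> 'b) encoding" where
  "enc_pair f g = (\<lambda>(a, b). {Node t u | t u. t \<in> f a \<and> u \<in> g b})"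

text \<open>A finite set is listed without repetitions, in any order.\<close>

definition enc_set :: "'a encoding \<Rightarrow> 'a set encoding" where
  "enc_set f S =
     {list_tree ts | ts xs. distinct xs \<and> set xs = S \<and> list_all2 (\<lambda>t x. t \<in> f x) ts xs}"

definition enc_af :: "nat af encoding" where
  "enc_af = enc_pair (enc_set enc_nat) (enc_set (enc_pair enc_nat enc_nat))"

section \<open>Parameterized problems\<close>

record 'i param_problem =
  is_instance :: "'i \<Rightarrow> bool"
  answer :: "'i \<Rightarrow> bool"
  parameter :: "'i \<Rightarrow> nat"
  encodings :: "'i encoding"

definition computable :: "(nat \<Rightarrow> nat) \<Rightarrow> bool" where
  "computable f \<longleftrightarrow> (\<exists>p. \<forall>n. \<exists>m. runs p (nat_tree n) m (nat_tree (f n)))"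

definition fixed_parameter_tractable :: "'i param_problem \<Rightarrow> bool" where
  "fixed_parameter_tractable P \<longleftrightarrow>
     (\<exists>f p d. computable f \<and>
        (\<forall>i. is_instance P i \<longrightarrow>
           (\<forall>t\<in>encodings P i.
              \<exists>n. runs p t n (bool_tree (answer P i)) \<and>
                  n \<le> f (parameter P i) * tree_size t ^ d)))"

text \<open>The framework is the first component of every instance.\<close>

definition restrict_degree ::
  "nat \<Rightarrow> (nat af \<times> 'r) param_problem \<Rightarrow> (nat af \<times> 'r) param_problem" where
  "restrict_degree c P = P\<lparr>is_instance := \<lambda>i. is_instance P i \<and> max_degree (fst i) \<le> c\<rparr>"

section \<open>The problems\<close>

type_synonym semantics = "nat af \<Rightarrow> nat set set"

definition Small :: "semantics \<Rightarrow> (nat af \<times> nat) param_problem" where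
  "Small \<sigma> = \<lparr>
     is_instance = \<lambda>(F, k). is_af F,
     answer = \<lambda>(F, k). \<exists>E\<in>\<sigma> F. E \<noteq> {} \<and> card E \<le> k,
     parameter = \<lambda>(F, k). k,
     encodings = enc_pair enc_af enc_nat\<rparr>"

definition Repair :: "semantics \<Rightarrow> (nat af \<times> nat set \<times> nat) param_problem" where
  "Repair \<sigma> = \<lparr>
     is_instance = \<lambda>(F, S, k). is_af F \<and> S \<subseteq> fst F,
     answer = \<lambda>(F, S, k). \<exists>E\<in>\<sigma> F. E \<noteq> {} \<and> dist E S \<le> k,
     parameter = \<lambda>(F, S, k). k,
     encodings = enc_pair enc_af (enc_pair (enc_set enc_nat) enc_nat)\<rparr>"

definition Adjust :: "semantics \<Rightarrow> (nat af \<times> nat set \<times> nat \<times> nat) param_problem" where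
  "Adjust \<sigma> = \<lparr>
     is_instance = \<lambda>(F, E\<^sub>0, t, k). is_af F \<and> E\<^sub>0 \<in> \<sigma> F \<and> t \<in> fst F,
     answer = \<lambda>(F, E\<^sub>0, t, k). \<exists>E\<in>\<sigma> F. dist E E\<^sub>0 \<le> k \<and> t \<in> sym_diff E\<^sub>0 E,
     parameter = \<lambda>(F, E\<^sub>0, t, k). k,
     encodings =
       enc_pair enc_af (enc_pair (enc_set enc_nat) (enc_pair enc_nat enc_nat))\<rparr>"

definition Center :: "semantics \<Rightarrow> (nat af \<times> nat set \<times> nat set) param_problem" where
  "Center \<sigma> = \<lparr>
     is_instance = \<lambda>(F, E\<^sub>1, E\<^sub>2). is_af F \<and> E\<^sub>1 \<in> \<sigma> F \<and> E\<^sub>2 \<in> \<sigma> F,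
     answer = \<lambda>(F, E\<^sub>1, E\<^sub>2).
       \<exists>E\<in>\<sigma> F. dist E E\<^sub>1 < dist E\<^sub>1 E\<^sub>2 \<and> dist E E\<^sub>2 < dist E\<^sub>1 E\<^sub>2,
     parameter = \<lambda>(F, E\<^sub>1, E\<^sub>2). dist E\<^sub>1 E\<^sub>2,
     encodings = enc_pair enc_af (enc_pair (enc_set enc_nat) (enc_set enc_nat))\<rparr>"

text \<open>No instance is left out for want of an encoding.\<close>

lemma enc_nat_nonempty: "enc_nat n \<noteq> {}"
  by (simp add: enc_nat_def)

lemma enc_pair_nonempty: "f a \<noteq> {} \<Longrightarrow> g b \<noteq> {} \<Longrightarrow> enc_pair f g (a, b) \<noteq> {}"
  by (auto simp: enc_pair_def)

lemma enc_set_nonempty: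
  assumes "finite S" and "\<And>x. f x \<noteq> {}"
  shows "enc_set f S \<noteq> {}"
proof -
  obtain xs where xs: "distinct xs" "set xs = S"
    using finite_distinct_list [OF assms(1)] by blast
  have "list_all2 (\<lambda>t x. t \<in> f x) (map (\<lambda>x. SOME t. t \<in> f x) xs) xs"
    using assms(2) by (auto simp: list_all2_conv_all_nth some_in_eq)
  with xs show ?thesis by (auto simp: enc_set_def)
qed

lemma enc_af_nonempty:
  assumes "is_af F"
  shows "enc_af F \<noteq> {}"
proof -
  obtain X A where F: "F = (X, A)" by (cases F)
  with assms have "finite X" "finite A"
    by (auto simp: is_af_def intro: finite_subset)
  moreover have "enc_pair enc_nat enc_nat x \<noteq> {}" for x
    by (cases x) (simp add: enc_pair_nonempty enc_nat_nonempty)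
  ultimately show ?thesis
    unfolding F enc_af_def by (intro enc_pair_nonempty enc_set_nonempty enc_nat_nonempty)
qed

lemma extensions_subset: "\<sigma> \<in> {adm, com, stb} \<Longrightarrow> E \<in> \<sigma> F \<Longrightarrow> E \<subseteq> fst F"
  by (auto simp: adm_def com_def stb_def conflict_free_def split: prod.splits)

lemma encodings_nonempty:
  assumes "\<sigma> \<in> {adm, com, stb}"
  shows "is_instance (Small \<sigma>) i \<Longrightarrow> encodings (Small \<sigma>) i \<noteq> {}"
    and "is_instance (Repair \<sigma>) j \<Longrightarrow> encodings (Repair \<sigma>) j \<noteq> {}"
    and "is_instance (Adjust \<sigma>) k \<Longrightarrow> encodings (Adjust \<sigma>) k \<noteq> {}"
    and "is_instance (Center \<sigma>) l \<Longrightarrow> encodings (Center \<sigma>) l \<noteq> {}"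
proof -
  have fin: "enc_set enc_nat S \<noteq> {}" if "is_af F" "S \<subseteq> fst F" for F and S :: "nat set"
    using that by (intro enc_set_nonempty enc_nat_nonempty)
      (auto simp: is_af_def intro: finite_subset split: prod.splits)
  have ext: "enc_set enc_nat E \<noteq> {}" if "is_af F" "E \<in> \<sigma> F" for F E
    using fin [OF that(1) extensions_subset [OF assms that(2)]] .
  note intros = enc_pair_nonempty enc_nat_nonempty enc_af_nonempty
  show "is_instance (Small \<sigma>) i \<Longrightarrow> encodings (Small \<sigma>) i \<noteq> {}"
    by (cases i) (simp add: Small_def intros)
  show "is_instance (Repair \<sigma>) j \<Longrightarrow> encodings (Repair \<sigma>) j \<noteq> {}"
    by (cases j rule: prod_cases3; simp add: Repair_def; intro intros; metis fin)
  show "is_instance (Adjust \<sigma>) k \<Longrightarrow> encodings (Adjust \<sigma>) k \<noteq> {}"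
    by (cases k rule: prod_cases4; simp add: Adjust_def; intro intros; metis ext)
  show "is_instance (Center \<sigma>) l \<Longrightarrow> encodings (Center \<sigma>) l \<noteq> {}"
    by (cases l rule: prod_cases3; simp add: Center_def; intro intros; metis ext)
qed

end

theory Submission
  imports Defs
begin

text \<open>
  Membership of \<open>E\<close> in \<open>\<sigma> F\<close> is a conjunction of constraints, one for each argument \<open>x\<close>, that
  depend only on the restriction of \<open>E\<close> to \<open>x\<close>, its attackers and their attackers. In bounded degree
  these are boundedly many arguments. If a set violates the constraint at \<open>x\<close>, then every solution
  differs from it at one of them, and flipping the right one decreases the distance to the solution. A
  search tree of bounded branching and of depth bounded by the parameter therefore finds a solution
  between the starting set and any given solution. Instead of building the tree, the program runs
  through all words that encode a branch. For Center it additionally guesses on which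
  arguments in the difference of \<open>E\<^sub>1\<close> and \<open>E\<^sub>2\<close> the solution deviates from \<open>E\<^sub>1\<close>.
\<close>

section \<open>Polynomial bounds\<close>

text \<open>The machine model shapes the file. WHILE programs have no procedures and no equality
  test, and sharing lets a short run build a huge tree. Time and size of total functions on trees
  are therefore bounded together and propagated through composition, branching and folds, so that
  the algorithm can be written as a function. One class serves both resource bounds:
  \<open>fptime\<close> measures in \<open>2 ^ \<kappa> t * tree_size t\<close>, and \<kappa> = 0 is
  polynomial time. Exponential growth enters only twice: when the binary parameter is turned into
  unary, and when the words are listed. The search may end at another solution than the one aimed
  at. Only what passes to every set between start and target can be guaranteed, and this dictates
  the starting sets. Distance passes by itself; nonemptiness and the status of a given argument do
  not, so the start is altered in one argument to agree with the target there.\<close>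

definition poly_bounded :: "(nat \<Rightarrow> nat) \<Rightarrow> bool" where
  "poly_bounded q \<longleftrightarrow> mono q \<and> (\<exists>C d. \<forall>n>0. q n \<le> C * n ^ d)"

lemma poly_bounded_mono: "poly_bounded q \<Longrightarrow> m \<le> n \<Longrightarrow> q m \<le> q n"
  by (simp add: poly_bounded_def monoD)

lemma poly_bounded_const [intro]: "poly_bounded (\<lambda>_. c)"
  unfolding poly_bounded_def by (rule conjI, simp add: mono_def, rule exI [of _ c], rule exI [of _ 0], simp)

lemma poly_bounded_id [intro]: "poly_bounded (\<lambda>n. n)"
  unfolding poly_bounded_def by (rule conjI, simp add: mono_def, rule exI [of _ 1], rule exI [of _ 1], simp)

text \<open>Both powers are dominated by the power whose exponent is the sum of the degrees. This
  can fail at \<open>n = 0\<close>, hence the restriction to positive arguments; tree sizes are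
  positive.\<close>

lemma poly_bounded_add [intro]:
  assumes "poly_bounded q" "poly_bounded r"
  shows "poly_bounded (\<lambda>n. q n + r n)"
proof -
  obtain C d C' d' where b: "\<And>n. n > 0 \<Longrightarrow> q n \<le> C * n ^ d" "\<And>n. n > 0 \<Longrightarrow> r n \<le> C' * n ^ d'"
    using assms by (auto simp: poly_bounded_def)
  have "q n + r n \<le> (C + C') * n ^ (d + d')" if "n > 0" for n
  proof -
    have "n ^ d \<le> n ^ (d + d')" "n ^ d' \<le> n ^ (d + d')"
      using that by (auto intro: power_increasing)
    then have "C * n ^ d + C' * n ^ d' \<le> C * n ^ (d + d') + C' * n ^ (d + d')"
      by (intro add_mono mult_left_mono) auto
    with b [OF that] show ?thesis by (simp add: algebra_simps)
  qed
  moreover have "mono (\<lambda>n. q n + r n)"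
    using assms by (auto simp: poly_bounded_def mono_def intro: add_mono)
  ultimately show ?thesis unfolding poly_bounded_def by blast
qed

lemma poly_bounded_mult [intro]:
  assumes "poly_bounded q" "poly_bounded r"
  shows "poly_bounded (\<lambda>n. q n * r n)"
proof -
  obtain C d C' d' where b: "\<And>n. n > 0 \<Longrightarrow> q n \<le> C * n ^ d" "\<And>n. n > 0 \<Longrightarrow> r n \<le> C' * n ^ d'"
    using assms by (auto simp: poly_bounded_def)
  have "q n * r n \<le> (C * C') * n ^ (d + d')" if "n > 0" for n
    using mult_mono [OF b(1) [OF that] b(2) [OF that]] by (simp add: power_add algebra_simps)
  moreover have "mono (\<lambda>n. q n * r n)"
    using assms by (auto simp: poly_bounded_def mono_def intro: mult_mono)
  ultimately show ?thesis unfolding poly_bounded_def by blast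
qed

lemma poly_bounded_power [intro]: "poly_bounded q \<Longrightarrow> poly_bounded (\<lambda>n. q n ^ m)"
  by (induction m) auto

lemma poly_bounded_comp:
  assumes "poly_bounded q" "poly_bounded r"
  shows "poly_bounded (\<lambda>n. q (r n))"
proof -
  obtain C d C' d' where b: "\<And>n. n > 0 \<Longrightarrow> q n \<le> C * n ^ d" "\<And>n. n > 0 \<Longrightarrow> r n \<le> C' * n ^ d'"
    using assms by (auto simp: poly_bounded_def)
  have "q (r n) \<le> (C * Suc C' ^ d) * n ^ (d' * d)" if "n > 0" for n
  proof -
    \<comment> \<open>\<open>Suc C'\<close> in place of \<open>C'\<close> keeps the argument of
      \<open>q\<close> positive, as the bound on \<open>q\<close> requires.\<close>
    have "r n \<le> Suc C' * n ^ d'" using b(2) [OF that] by simp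
    then have "q (r n) \<le> q (Suc C' * n ^ d')" by (rule poly_bounded_mono [OF assms(1)])
    also have "\<dots> \<le> C * (Suc C' * n ^ d') ^ d" using that by (intro b(1)) simp
    finally show ?thesis by (simp add: power_mult_distrib power_mult mult.assoc del: mult_Suc)
  qed
  moreover have "mono (\<lambda>n. q (r n))"
    using assms by (auto simp: poly_bounded_def mono_def)
  ultimately show ?thesis unfolding poly_bounded_def by blast
qed

section \<open>Programs that compute functions on trees\<close>

text \<open>
  To make programs composable without renaming of variables, variable 0 holds the argument and the
  result, variable 1 holds a stack that every program leaves as it found it, and variable 2 is
  scratch space.
\<close>

definition computes :: "cmd \<Rightarrow> (tree \<Rightarrow> tree) \<Rightarrow> (tree \<Rightarrow> nat) \<Rightarrow> bool" where
  "computes p f T \<longleftrightarrow>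
     (\<forall>s. \<exists>n s'. exec p s n s' \<and> s' 0 = f (s 0) \<and> s' 1 = s 1 \<and> n \<le> T (s 0))"

lemma computesE:
  assumes "computes p f T"
  obtains n s' where "exec p s n s'" "s' 0 = f (s 0)" "s' 1 = s 1" "n \<le> T (s 0)"
  using assms unfolding computes_def by blast

lemma computes_expr:
  assumes "\<And>s. eval_expr e s = f (s 0)"
  shows "computes (Assign 0 e) f (\<lambda>_. 1 + cost e)"
  unfolding computes_def
proof
  fix s
  show "\<exists>n s'. exec (Assign 0 e) s n s' \<and> s' 0 = f (s 0) \<and> s' 1 = s 1 \<and> n \<le> 1 + cost e"
    using exec_Assign [of 0 e s] assms by fastforce
qed

lemma computes_seq:
  assumes "computes p f T" "computes q g U"
  shows "computes (Seq p q) (\<lambda>t. g (f t)) (\<lambda>t. 1 + T t + U (f t))"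
  unfolding computes_def
proof
  fix s
  obtain m s1 where 1: "exec p s m s1" "s1 0 = f (s 0)" "s1 1 = s 1" "m \<le> T (s 0)"
    using assms(1) by (rule computesE)
  obtain n s2 where 2: "exec q s1 n s2" "s2 0 = g (s1 0)" "s2 1 = s1 1" "n \<le> U (s1 0)"
    using assms(2) by (rule computesE)
  show "\<exists>n s'. exec (Seq p q) s n s' \<and> s' 0 = g (f (s 0)) \<and> s' 1 = s 1 \<and> n \<le> 1 + T (s 0) + U (f (s 0))"
    by (rule exI, rule exI, rule conjI, rule exec_Seq [OF 1(1) 2(1)]) (use 1 2 in auto)
qed

text \<open>The argument waits on the stack while \<open>p\<close> runs and is then exchanged for
  the first result, which waits there while \<open>q\<close> runs. Variable 2 is live only between
  the two runs, so neither program can spoil it. The 40 generously covers six assignments and seven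
  sequencings.\<close>

lemma computes_pair:
  assumes "computes p f T" "computes q g U"
  shows "\<exists>r. computes r (\<lambda>t. Node (f t) (g t)) (\<lambda>t. 40 + T t + U t)"
proof -
  let ?a = "Assign 1 (ENode (Var 0) (Var 1))"
  let ?b = "Assign 2 (ELeft (Var 1))"
  let ?c = "Assign 1 (ENode (Var 0) (ERight (Var 1)))"
  let ?d = "Assign 0 (Var 2)"
  let ?e = "Assign 0 (ENode (ELeft (Var 1)) (Var 0))"
  let ?f = "Assign 1 (ERight (Var 1))"
  let ?r = "Seq ?a (Seq p (Seq ?b (Seq ?c (Seq ?d (Seq q (Seq ?e ?f))))))"
  have "computes ?r (\<lambda>t. Node (f t) (g t)) (\<lambda>t. 40 + T t + U t)"
    unfolding computes_def
  proof
    fix s :: state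
    let ?s1 = "s(1 := eval_expr (ENode (Var 0) (Var 1)) s)"
    obtain m s2 where 2: "exec p ?s1 m s2" "s2 0 = f (?s1 0)" "s2 1 = ?s1 1" "m \<le> T (?s1 0)"
      using assms(1) by (rule computesE)
    let ?s3 = "s2(2 := eval_expr (ELeft (Var 1)) s2)"
    let ?s4 = "?s3(1 := eval_expr (ENode (Var 0) (ERight (Var 1))) ?s3)"
    let ?s5 = "?s4(0 := eval_expr (Var 2) ?s4)"
    obtain n s6 where 6: "exec q ?s5 n s6" "s6 0 = g (?s5 0)" "s6 1 = ?s5 1" "n \<le> U (?s5 0)"
      using assms(2) by (rule computesE)
    note ex = exec_Seq [OF exec_Assign exec_Seq [OF 2(1) exec_Seq [OF exec_Assign
      exec_Seq [OF exec_Assign exec_Seq [OF exec_Assign exec_Seq [OF 6(1)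
      exec_Seq [OF exec_Assign exec_Assign]]]]]]]
    show "\<exists>n s'. exec ?r s n s' \<and> s' 0 = Node (f (s 0)) (g (s 0)) \<and> s' 1 = s 1 \<and>
        n \<le> 40 + T (s 0) + U (s 0)"
      by (rule exI, rule exI, rule conjI, rule ex) (use 2 6 in auto)
  qed
  then show ?thesis ..
qed

lemma computes_cond:
  assumes "computes p f T" "computes q g U"
  shows "computes (Cond (ELeft (Var 0)) p q) (\<lambda>t. if left t \<noteq> Leaf then f t else g t)
    (\<lambda>t. 3 + T t + U t)"
  unfolding computes_def
proof
  fix s
  obtain m s1 where 1: "exec p s m s1" "s1 0 = f (s 0)" "s1 1 = s 1" "m \<le> T (s 0)"
    using assms(1) by (rule computesE)
  obtain n s2 where 2: "exec q s n s2" "s2 0 = g (s 0)" "s2 1 = s 1" "n \<le> U (s 0)"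
    using assms(2) by (rule computesE)
  let ?e = "ELeft (Var 0)"
  show "\<exists>n s'. exec (Cond ?e p q) s n s' \<and> s' 0 = (if left (s 0) \<noteq> Leaf then f (s 0) else g (s 0)) \<and>
      s' 1 = s 1 \<and> n \<le> 3 + T (s 0) + U (s 0)"
  proof (cases "eval_expr ?e s = Leaf")
    case True
    show ?thesis
      by (rule exI, rule exI, rule conjI, rule exec_Cond_false [OF True 2(1)]) (use True 2 in auto)
  next
    case False
    show ?thesis
      by (rule exI, rule exI, rule conjI, rule exec_Cond_true [OF False 1(1)]) (use False 1 in auto)
  qed
qed

text \<open>Every tree is the list along its right spine, so this is a total inverse of
  \<open>list_tree\<close> and list functions need no well-formedness hypotheses.\<close>

fun lst :: "tree \<Rightarrow> tree list" where
  "lst Leaf = []"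
| "lst (Node a b) = a # lst b"

lemma lst_list_tree [simp]: "lst (list_tree xs) = xs"
  by (induction xs) auto

lemma list_tree_lst [simp]: "list_tree (lst t) = t"
  by (induction t) auto

lemma list_tree_eq_Leaf [simp]: "list_tree xs = Leaf \<longleftrightarrow> xs = []"
  by (cases xs) auto

lemma right_list_tree [simp]: "right (list_tree xs) = list_tree (tl xs)"
  by (cases xs) auto

lemma tree_size_pos [simp]: "tree_size t > 0"
  by (cases t) auto

lemma tree_size_left: "tree_size (left t) \<le> tree_size t"
  by (cases t) auto

lemma tree_size_right: "tree_size (right t) \<le> tree_size t"
  by (cases t) auto

lemma length_lst: "length (lst t) < tree_size t"
  by (induction t rule: lst.induct) auto

lemma tree_size_mem_lst: "y \<in> set (lst t) \<Longrightarrow> tree_size y < tree_size t"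
  by (induction t rule: lst.induct) auto

lemma tree_size_list_tree_drop: "tree_size (list_tree (drop i xs)) \<le> tree_size (list_tree xs)"
proof (induction xs arbitrary: i)
  case (Cons x xs)
  then show ?case by (cases i) (auto intro: trans_le_add2 le_SucI)
qed simp

text \<open>The loop state consists of the rest of the list, the context, and the accumulator.\<close>

lemma exec_fold_loop:
  assumes p: "computes p b T"
    and b: "\<And>y ys c a. b (Node (Node y ys) (Node c a)) = Node ys (Node c (h c y a))"
    and K: "\<And>i. i \<le> length ys \<Longrightarrow>
      T (Node (list_tree (drop i ys)) (Node c (foldl (\<lambda>a y. h c y a) a (take i ys)))) \<le> K"
    and s: "s 0 = Node (list_tree ys) (Node c a)"
  shows "\<exists>n s'. exec (While (ELeft (Var 0)) p) s n s' \<and>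
    s' 0 = Node Leaf (Node c (foldl (\<lambda>a y. h c y a) a ys)) \<and> s' 1 = s 1 \<and> n \<le> (K + 3) * length ys + 3"
  using K s
proof (induction ys arbitrary: a s)
  case Nil
  then have "eval_expr (ELeft (Var 0)) s = Leaf" by simp
  from exec_While_false [OF this] Nil show ?case by fastforce
next
  case (Cons y ys)
  obtain m s1 where 1: "exec p s m s1" "s1 0 = b (s 0)" "s1 1 = s 1" "m \<le> T (s 0)"
    using p by (rule computesE)
  have "T (Node (list_tree (drop i ys)) (Node c (foldl (\<lambda>a y. h c y a) (h c y a) (take i ys)))) \<le> K"
    if "i \<le> length ys" for i
    using Cons.prems(1) [of "Suc i"] that by simp
  moreover have "s1 0 = Node (list_tree ys) (Node c (h c y a))"
    using 1 Cons.prems by (simp add: b)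
  ultimately obtain n s2 where 2: "exec (While (ELeft (Var 0)) p) s1 n s2"
    "s2 0 = Node Leaf (Node c (foldl (\<lambda>a y. h c y a) (h c y a) ys))" "s2 1 = s1 1"
    "n \<le> (K + 3) * length ys + 3"
    using Cons.IH by blast
  have m: "m \<le> K" using Cons.prems(1) [of 0] 1 Cons.prems(2) by simp
  have "eval_expr (ELeft (Var 0)) s \<noteq> Leaf" using Cons.prems by simp
  note ex = exec_While_true [OF this 1(1) 2(1)]
  show ?case
    by (rule exI, rule exI, rule conjI, rule ex) (use m 1 2 in \<open>auto simp: algebra_simps\<close>)
qed

section \<open>Fixed-parameter tractable and polynomial-time functions\<close>

text \<open>\<open>ENode (Var 0) (Var 0)\<close> doubles a tree at constant cost, so a time bound
  does not control the size of the result, and composition needs that size. Measuring in the single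
  product of \<open>2 ^ \<kappa> t\<close> and the size allows polynomials in one variable.\<close>

definition fptime :: "(tree \<Rightarrow> nat) \<Rightarrow> (tree \<Rightarrow> tree) \<Rightarrow> bool" where
  "fptime \<kappa> f \<longleftrightarrow> (\<exists>p q. poly_bounded q \<and> computes p f (\<lambda>t. q (2 ^ \<kappa> t * tree_size t)) \<and>
     (\<forall>t. tree_size (f t) \<le> q (2 ^ \<kappa> t * tree_size t)))"

abbreviation polytime :: "(tree \<Rightarrow> tree) \<Rightarrow> bool" where
  "polytime \<equiv> fptime (\<lambda>_. 0)"

lemma computes_mono: "computes p f T \<Longrightarrow> (\<And>t. T t \<le> U t) \<Longrightarrow> computes p f U"
  unfolding computes_def using le_trans by blast

lemma fptimeI:
  assumes "computes p f T" "poly_bounded q" "\<And>t. T t \<le> q (2 ^ \<kappa> t * tree_size t)"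
    and "poly_bounded r" "\<And>t. tree_size (f t) \<le> r (2 ^ \<kappa> t * tree_size t)"
  shows "fptime \<kappa> f"
  unfolding fptime_def
proof (intro exI conjI allI)
  show "poly_bounded (\<lambda>n. q n + r n)" using assms by blast
  show "computes p f (\<lambda>t. q (2 ^ \<kappa> t * tree_size t) + r (2 ^ \<kappa> t * tree_size t))"
    using assms(1) by (rule computes_mono) (simp add: assms(3) trans_le_add1)
  show "tree_size (f t) \<le> q (2 ^ \<kappa> t * tree_size t) + r (2 ^ \<kappa> t * tree_size t)" for t
    by (simp add: assms(5) trans_le_add2)
qed

lemma fptimeE:
  assumes "fptime \<kappa> f"
  obtains p q where "poly_bounded q" "computes p f (\<lambda>t. q (2 ^ \<kappa> t * tree_size t))"
    "\<And>t. tree_size (f t) \<le> q (2 ^ \<kappa> t * tree_size t)"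
  using assms unfolding fptime_def by blast

lemma fptime_mono:
  assumes "fptime \<kappa> f" "\<And>t. \<kappa> t \<le> \<kappa>' t"
  shows "fptime \<kappa>' f"
proof -
  obtain p q where 1: "poly_bounded q" "computes p f (\<lambda>t. q (2 ^ \<kappa> t * tree_size t))"
    "\<And>t. tree_size (f t) \<le> q (2 ^ \<kappa> t * tree_size t)"
    using assms(1) by (rule fptimeE) blast
  have *: "q (2 ^ \<kappa> t * tree_size t) \<le> q (2 ^ \<kappa>' t * tree_size t)" for t
    using assms(2) by (intro poly_bounded_mono [OF 1(1)] mult_right_mono power_increasing) auto
  show ?thesis
    by (rule fptimeI [OF 1(2) 1(1) * 1(1)]) (rule le_trans [OF 1(3) *])
qed

lemma size_le_weighted: "tree_size t \<le> 2 ^ k * tree_size t"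
  by simp

section \<open>Closure under basic operations, composition, branching and folds\<close>

lemma fptime_id: "fptime \<kappa> (\<lambda>t. t)"
  by (rule fptimeI [OF computes_expr [of "Var 0"] poly_bounded_const le_refl poly_bounded_id]) auto

fun tree_expr :: "tree \<Rightarrow> expr" where
  "tree_expr Leaf = ELeaf"
| "tree_expr (Node a b) = ENode (tree_expr a) (tree_expr b)"

lemma eval_tree_expr [simp]: "eval_expr (tree_expr t) s = t"
  by (induction t) auto

lemma fptime_const: "fptime \<kappa> (\<lambda>_. c)"
  by (rule fptimeI [OF computes_expr [of "tree_expr c"] poly_bounded_const le_refl poly_bounded_const]) auto

lemma polytime_left0: "polytime left"
  by (rule fptimeI [OF computes_expr [of "ELeft (Var 0)"] poly_bounded_const le_refl poly_bounded_id])
    (auto simp: tree_size_left)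

lemma polytime_right0: "polytime right"
  by (rule fptimeI [OF computes_expr [of "ERight (Var 0)"] poly_bounded_const le_refl poly_bounded_id])
    (auto simp: tree_size_right)

text \<open>For weight \<open>N\<close> of the input, the intermediate result has size at most
  \<open>q N\<close>, and its own exponential factor is at most \<open>N\<close> because the
  parameter does not grow. The second program is thus charged for \<open>N * q N\<close>, again
  polynomial in \<open>N\<close>.\<close>

lemma fptime_comp':
  assumes "fptime \<kappa> f" "fptime \<kappa>' g" "\<And>t. \<kappa>' (f t) \<le> \<kappa> t"
  shows "fptime \<kappa> (\<lambda>t. g (f t))"
proof -
  obtain p q where 1: "poly_bounded q" "computes p f (\<lambda>t. q (2 ^ \<kappa> t * tree_size t))"
    "\<And>t. tree_size (f t) \<le> q (2 ^ \<kappa> t * tree_size t)"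
    using assms(1) by (rule fptimeE) blast
  obtain p' r where 2: "poly_bounded r" "computes p' g (\<lambda>t. r (2 ^ \<kappa>' t * tree_size t))"
    "\<And>t. tree_size (g t) \<le> r (2 ^ \<kappa>' t * tree_size t)"
    using assms(2) by (rule fptimeE) blast
  let ?N = "\<lambda>t. 2 ^ \<kappa> t * tree_size t"
  have *: "r (2 ^ \<kappa>' (f t) * tree_size (f t)) \<le> r (?N t * q (?N t))" for t
  proof (intro poly_bounded_mono [OF 2(1)] mult_mono 1(3))
    have "(2::nat) ^ \<kappa>' (f t) \<le> 2 ^ \<kappa> t" using assms(3) by (intro power_increasing) auto
    then show "2 ^ \<kappa>' (f t) \<le> ?N t"
      using mult_le_mono [of "2 ^ \<kappa>' (f t)" "2 ^ \<kappa> t" 1 "tree_size t"] by (simp add: Suc_le_eq)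
  qed auto
  have r: "poly_bounded (\<lambda>n. r (n * q n))"
    by (rule poly_bounded_comp [OF 2(1)]) (intro poly_bounded_mult poly_bounded_id 1)
  have t: "1 + q (?N t) + r (2 ^ \<kappa>' (f t) * tree_size (f t)) \<le> 1 + q (?N t) + r (?N t * q (?N t))" for t
    using * by simp
  show ?thesis
    by (rule fptimeI [OF computes_seq [OF 1(2) 2(2)] _ t r])
      (intro poly_bounded_add poly_bounded_const 1 r, rule le_trans [OF 2(3) *])
qed

lemma fptime_comp: "polytime g \<Longrightarrow> fptime \<kappa> f \<Longrightarrow> fptime \<kappa> (\<lambda>t. g (f t))"
  by (rule fptime_comp' [of \<kappa> f "\<lambda>_. 0"]) simp_all

lemma fptime_left: "fptime \<kappa> f \<Longrightarrow> fptime \<kappa> (\<lambda>t. left (f t))"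
  by (rule fptime_comp [OF polytime_left0])

lemma fptime_right: "fptime \<kappa> f \<Longrightarrow> fptime \<kappa> (\<lambda>t. right (f t))"
  by (rule fptime_comp [OF polytime_right0])

lemma fptime_Node:
  assumes "fptime \<kappa> f" "fptime \<kappa> g"
  shows "fptime \<kappa> (\<lambda>t. Node (f t) (g t))"
proof -
  obtain p q where 1: "poly_bounded q" "computes p f (\<lambda>t. q (2 ^ \<kappa> t * tree_size t))"
    "\<And>t. tree_size (f t) \<le> q (2 ^ \<kappa> t * tree_size t)"
    using assms(1) by (rule fptimeE) blast
  obtain p' r where 2: "poly_bounded r" "computes p' g (\<lambda>t. r (2 ^ \<kappa> t * tree_size t))"
    "\<And>t. tree_size (g t) \<le> r (2 ^ \<kappa> t * tree_size t)"
    using assms(2) by (rule fptimeE) blast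
  obtain u where u: "computes u (\<lambda>t. Node (f t) (g t))
      (\<lambda>t. 40 + q (2 ^ \<kappa> t * tree_size t) + r (2 ^ \<kappa> t * tree_size t))"
    using computes_pair [OF 1(2) 2(2)] by blast
  have *: "poly_bounded (\<lambda>n. 40 + q n + r n)"
    by (intro poly_bounded_add poly_bounded_const 1 2)
  show ?thesis
  proof (rule fptimeI [OF u * le_refl *])
    show "tree_size (Node (f t) (g t)) \<le> 40 + q (2 ^ \<kappa> t * tree_size t) + r (2 ^ \<kappa> t * tree_size t)" for t
      using 1(3) [of t] 2(3) [of t] by simp
  qed
qed

text \<open>The test and both branches are all evaluated and packed into one tree, and then a branch
  is picked. Since all functions are total and bounded, the wasted branch does no harm.\<close>

lemma fptime_If_Leaf:
  assumes b: "fptime \<kappa> b" and f: "fptime \<kappa> f" and g: "fptime \<kappa> g"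
  shows "fptime \<kappa> (\<lambda>t. if b t \<noteq> Leaf then f t else g t)"
proof -
  let ?c = "\<lambda>t. if left t \<noteq> Leaf then left (right t) else right (right t)"
  have l: "polytime (\<lambda>t. left (right t))" and r: "polytime (\<lambda>t. right (right t))"
    by (intro fptime_left fptime_right fptime_id)+
  obtain p q where 1: "poly_bounded q" "computes p (\<lambda>t. left (right t)) (\<lambda>t. q (2 ^ 0 * tree_size t))"
    using l by (rule fptimeE) blast
  obtain p' q' where 2: "poly_bounded q'" "computes p' (\<lambda>t. right (right t)) (\<lambda>t. q' (2 ^ 0 * tree_size t))"
    using r by (rule fptimeE) blast
  have "polytime ?c"
  proof (rule fptimeI [OF computes_cond [OF 1(2) 2(2)] _ le_refl poly_bounded_id])
    show "poly_bounded (\<lambda>n. 3 + q n + q' n)"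
      by (intro poly_bounded_add poly_bounded_const 1 2)
    show "tree_size (if left t \<noteq> Leaf then left (right t) else right (right t)) \<le> 2 ^ 0 * tree_size t" for t
      using le_trans [OF tree_size_left tree_size_right] le_trans [OF tree_size_right tree_size_right]
      by simp
  qed
  from fptime_comp [OF this fptime_Node [OF b fptime_Node [OF f g]]]
  show ?thesis unfolding left.simps right.simps .
qed

text \<open>Iterating a polynomial-time body may blow up the accumulator beyond every polynomial, so
  a bound on all intermediate accumulators is a hypothesis. The next two lemmas supply it, for
  additive and for multiplicative growth.\<close>

lemma fptime_fold_bounded:
  assumes H: "polytime (\<lambda>u. h (left u) (left (right u)) (right (right u)))"
    and l: "fptime \<kappa> l" and a: "fptime \<kappa> a" and z: "poly_bounded z"
    and bd: "\<And>t i. i \<le> length (lst (l t)) \<Longrightarrow>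
      tree_size (foldl (\<lambda>acc y. h t y acc) (a t) (take i (lst (l t)))) \<le> z (2 ^ \<kappa> t * tree_size t)"
  shows "fptime \<kappa> (\<lambda>t. foldl (\<lambda>acc y. h t y acc) (a t) (lst (l t)))"
proof -
  define b where "b u = Node (right (left u)) (Node (left (right u))
    (h (left (right u)) (left (left u)) (right (right u))))" for u
  have "polytime (\<lambda>u. Node (left (right u)) (Node (left (left u)) (right (right u))))"
    by (intro fptime_Node fptime_left fptime_right fptime_id)
  from fptime_comp [OF H this]
  have "polytime (\<lambda>u. h (left (right u)) (left (left u)) (right (right u)))" by simp
  then have "polytime b" unfolding b_def
    by (intro fptime_Node fptime_left fptime_right fptime_id)
  then obtain p q where q: "poly_bounded q" and p: "computes p b (\<lambda>t. q (tree_size t))"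
    by (rule fptimeE) simp
  have "fptime \<kappa> (\<lambda>t. Node (l t) (Node t (a t)))"
    by (intro fptime_Node fptime_id l a)
  then obtain p' r where r: "poly_bounded r"
    and p': "computes p' (\<lambda>t. Node (l t) (Node t (a t))) (\<lambda>t. r (2 ^ \<kappa> t * tree_size t))"
    and r': "\<And>t. tree_size (Node (l t) (Node t (a t))) \<le> r (2 ^ \<kappa> t * tree_size t)"
    by (rule fptimeE) blast
  let ?N = "\<lambda>t. 2 ^ \<kappa> t * tree_size t"
  \<comment> \<open>Cost of one round on a loop state of maximal size: two inner nodes, the rest of
    the list (\<open>r n\<close>), the input as context (\<open>n\<close>) and the accumulator
    (\<open>z n\<close>).\<close>
  let ?K = "\<lambda>n. q (2 + r n + n + z n)"
  let ?T = "\<lambda>n. 1 + r n + (1 + ((?K n + 3) * r n + 3) + 4)"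
  let ?r = "Seq p' (Seq (While (ELeft (Var 0)) p) (Assign 0 (ERight (ERight (Var 0)))))"
  let ?f = "\<lambda>t. foldl (\<lambda>acc y. h t y acc) (a t) (lst (l t))"
  have "computes ?r ?f (\<lambda>t. ?T (?N t))"
    unfolding computes_def
  proof
    fix s :: state
    let ?t = "s 0"
    obtain m s1 where 1: "exec p' s m s1" "s1 0 = Node (l ?t) (Node ?t (a ?t))" "s1 1 = s 1"
      "m \<le> r (?N ?t)"
      using p' by (rule computesE)
    have "\<exists>n s'. exec (While (ELeft (Var 0)) p) s1 n s' \<and>
      s' 0 = Node Leaf (Node ?t (?f ?t)) \<and> s' 1 = s1 1 \<and> n \<le> (?K (?N ?t) + 3) * length (lst (l ?t)) + 3"
    proof (rule exec_fold_loop [OF p])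
      show "b (Node (Node y ys) (Node c a)) = Node ys (Node c (h c y a))" for y ys c a
        by (simp add: b_def)
      show "s1 0 = Node (list_tree (lst (l ?t))) (Node ?t (a ?t))" using 1 by simp
      fix i assume i: "i \<le> length (lst (l ?t))"
      have "tree_size (list_tree (drop i (lst (l ?t)))) \<le> r (?N ?t)"
        using tree_size_list_tree_drop [of i "lst (l ?t)"] r' [of ?t] by simp
      with bd [OF i]
      show "q (tree_size (Node (list_tree (drop i (lst (l ?t))))
          (Node ?t (foldl (\<lambda>acc y. h ?t y acc) (a ?t) (take i (lst (l ?t))))))) \<le> ?K (?N ?t)"
        using size_le_weighted [of ?t "\<kappa> ?t"] unfolding tree_size.simps
        by (intro poly_bounded_mono [OF q]) linarith
    qed
    then obtain n s2 where 2: "exec (While (ELeft (Var 0)) p) s1 n s2"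
      "s2 0 = Node Leaf (Node ?t (?f ?t))" "s2 1 = s1 1"
      "n \<le> (?K (?N ?t) + 3) * length (lst (l ?t)) + 3" by blast
    have "length (lst (l ?t)) \<le> r (?N ?t)"
      using length_lst [of "l ?t"] r' [of ?t] by simp
    then have "(?K (?N ?t) + 3) * length (lst (l ?t)) \<le> (?K (?N ?t) + 3) * r (?N ?t)"
      by (rule mult_left_mono) simp
    with 2(4) have n: "n \<le> (?K (?N ?t) + 3) * r (?N ?t) + 3" by linarith
    have c: "cost (ERight (ERight (Var 0))) = 3" by simp
    show "\<exists>n s'. exec ?r s n s' \<and> s' 0 = ?f ?t \<and> s' 1 = s 1 \<and> n \<le> ?T (?N ?t)"
      by (rule exI, rule exI, rule conjI, rule exec_Seq [OF 1(1) exec_Seq [OF 2(1) exec_Assign]])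
        (use 1(2-4) 2(2,3) n in \<open>simp only: c, simp\<close>)
  qed
  moreover have "poly_bounded (\<lambda>n. 2 + r n + n + z n)"
    by (intro poly_bounded_add poly_bounded_const poly_bounded_id r z)
  from poly_bounded_comp [OF q this] have "poly_bounded ?T"
    by (intro poly_bounded_add poly_bounded_mult poly_bounded_const r)
  moreover have "tree_size (?f t) \<le> z (?N t)" for t
    using bd [OF le_refl] by simp
  ultimately show ?thesis
    using z by (blast intro: fptimeI)
qed

text \<open>The growth per round does not depend on the accumulator, so the sizes add up to at most
  the initial size plus the number of rounds times a polynomial.\<close>

lemma fptime_fold:
  assumes H: "polytime (\<lambda>u. h (left u) (left (right u)) (right (right u)))"
    and l: "fptime \<kappa> l" and a: "fptime \<kappa> a"
    and g: "polytime (\<lambda>u. g (left u) (right u))"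
    and bd: "\<And>t y acc. tree_size (h t y acc) \<le> tree_size acc + tree_size (g t y)"
  shows "fptime \<kappa> (\<lambda>t. foldl (\<lambda>acc y. h t y acc) (a t) (lst (l t)))"
proof -
  let ?N = "\<lambda>t. 2 ^ \<kappa> t * tree_size t"
  obtain p q where q: "poly_bounded q" "\<And>u. tree_size (g (left u) (right u)) \<le> q (tree_size u)"
    using g by (rule fptimeE) simp
  have "fptime \<kappa> (\<lambda>t. Node (l t) (a t))" by (intro fptime_Node l a)
  then obtain p' r where r: "poly_bounded r" "\<And>t. tree_size (Node (l t) (a t)) \<le> r (?N t)"
    by (rule fptimeE) blast
  let ?z = "\<lambda>n. r n + r n * q (1 + n + r n)"
  have "poly_bounded (\<lambda>n. 1 + n + r n)"
    by (intro poly_bounded_add poly_bounded_const poly_bounded_id r)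
  from poly_bounded_comp [OF q(1) this] have "poly_bounded ?z"
    by (intro poly_bounded_add poly_bounded_mult r)
  then show ?thesis
  proof (rule fptime_fold_bounded [OF H l a])
    fix t i assume i: "i \<le> length (lst (l t))"
    have "tree_size (g t y) \<le> q (1 + ?N t + r (?N t))" if "y \<in> set (lst (l t))" for y
    proof -
      have "tree_size y \<le> r (?N t)"
        using tree_size_mem_lst [OF that] r(2) [of t] by simp
      then have "tree_size (Node t y) \<le> 1 + ?N t + r (?N t)"
        unfolding tree_size.simps by (intro add_mono le_refl size_le_weighted)
      from poly_bounded_mono [OF q(1) this] q(2) [of "Node t y"] show ?thesis by simp
    qed
    then have "tree_size (foldl (\<lambda>acc y. h t y acc) acc ys)
        \<le> tree_size acc + length ys * q (1 + ?N t + r (?N t))" if "set ys \<subseteq> set (lst (l t))" for acc ys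
      using that
    proof (induction ys arbitrary: acc)
      case (Cons y ys)
      have "tree_size (h t y acc) \<le> tree_size acc + q (1 + ?N t + r (?N t))"
        using bd [of t y acc] Cons.prems by fastforce
      with Cons.IH [of "h t y acc"] Cons.prems show ?case by fastforce
    qed simp
    from this [of "take i (lst (l t))" "a t"]
    have "tree_size (foldl (\<lambda>acc y. h t y acc) (a t) (take i (lst (l t))))
        \<le> tree_size (a t) + i * q (1 + ?N t + r (?N t))"
      using i by (simp add: set_take_subset)
    also have "\<dots> \<le> r (?N t) + r (?N t) * q (1 + ?N t + r (?N t))"
      using i length_lst [of "l t"] r(2) [of t] by (intro add_mono mult_right_mono) auto
    finally show "tree_size (foldl (\<lambda>acc y. h t y acc) (a t) (take i (lst (l t)))) \<le> ?z (?N t)" .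
  qed
qed

text \<open>At most \<open>\<kappa> t\<close> rounds multiply the size by \<open>m\<close> each, and
  \<open>m ^ \<kappa> t\<close> is at most \<open>(2 ^ \<kappa> t) ^ m\<close> because
  \<open>m \<le> 2 ^ m\<close>. For constant \<open>m\<close> this is a fixed power of the
  weight.\<close>

lemma fptime_fold_exponential:
  assumes H: "polytime (\<lambda>u. h (left u) (right u))"
    and bd: "\<And>y acc. tree_size (h y acc) \<le> m * tree_size acc"
    and a: "fptime \<kappa> a" and l: "fptime \<kappa> l" and len: "\<And>t. length (lst (l t)) \<le> \<kappa> t"
  shows "fptime \<kappa> (\<lambda>t. foldl (\<lambda>acc y. h y acc) (a t) (lst (l t)))"
proof -
  let ?N = "\<lambda>t. 2 ^ \<kappa> t * tree_size t"
  obtain p r where r: "poly_bounded r" "\<And>t. tree_size (a t) \<le> r (?N t)"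
    using a by (rule fptimeE) blast
  have H': "polytime (\<lambda>u. h (left (right u)) (right (right u)))"
    by (rule fptime_comp [OF H fptime_right [OF fptime_id]])
  have "poly_bounded (\<lambda>n. n ^ m * r n)"
    by (intro poly_bounded_mult poly_bounded_power poly_bounded_id r)
  then show ?thesis
  proof (rule fptime_fold_bounded [where h = "\<lambda>t. h", OF H' l a])
    fix t i assume i: "i \<le> length (lst (l t))"
    have *: "tree_size (foldl (\<lambda>acc y. h y acc) acc ys) \<le> m ^ length ys * tree_size acc" for ys acc
    proof (induction ys arbitrary: acc)
      case (Cons y ys)
      have "tree_size (foldl (\<lambda>acc y. h y acc) acc (y # ys)) \<le> m ^ length ys * tree_size (h y acc)"
        using Cons.IH by simp
      also have "\<dots> \<le> m ^ length ys * (m * tree_size acc)"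
        by (intro mult_left_mono bd) simp
      finally show ?case by (simp add: mult.assoc mult.left_commute)
    qed simp
    have "m ^ i \<le> (2 ^ m) ^ i" by (intro power_mono) (auto intro: less_imp_le less_exp)
    also have "\<dots> \<le> (2 ^ m) ^ \<kappa> t" using i len [of t] by (intro power_increasing) auto
    also have "\<dots> = (2 ^ \<kappa> t) ^ m" by (simp add: power_mult [symmetric] mult.commute)
    also have "\<dots> \<le> ?N t ^ m" by (intro power_mono) (auto simp: Suc_le_eq)
    finally have "m ^ i \<le> ?N t ^ m" .
    then have "m ^ i * tree_size (a t) \<le> ?N t ^ m * r (?N t)" by (intro mult_mono r) auto
    with * [of "a t" "take i (lst (l t))"] i
    show "tree_size (foldl (\<lambda>acc y. h y acc) (a t) (take i (lst (l t)))) \<le> ?N t ^ m * r (?N t)"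
      by (simp add: min_absorb2)
  qed
qed

section \<open>A calculus of polynomial-time list functions\<close>

definition ptest :: "(tree \<Rightarrow> bool) \<Rightarrow> bool" where
  "ptest P \<longleftrightarrow> polytime (\<lambda>t. bool_tree (P t))"

definition plist :: "(tree \<Rightarrow> tree list) \<Rightarrow> bool" where
  "plist F \<longleftrightarrow> polytime (\<lambda>t. list_tree (F t))"

lemma bool_tree_eq_Leaf [simp]: "bool_tree b = Leaf \<longleftrightarrow> \<not> b"
  by (simp add: bool_tree_def)

lemma polytime_list_tree: "plist F \<Longrightarrow> polytime (\<lambda>t. list_tree (F t))"
  by (simp add: plist_def)

lemma plist_lst: "polytime f \<Longrightarrow> plist (\<lambda>t. lst (f t))"
  by (simp add: plist_def)

lemma ptest_comp: "ptest P \<Longrightarrow> polytime g \<Longrightarrow> ptest (\<lambda>t. P (g t))"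
  unfolding ptest_def by (rule fptime_comp)

lemma plist_comp: "plist F \<Longrightarrow> polytime g \<Longrightarrow> plist (\<lambda>t. F (g t))"
  unfolding plist_def by (rule fptime_comp)

lemma polytime_If:
  assumes "ptest P" "polytime f" "polytime g"
  shows "polytime (\<lambda>t. if P t then f t else g t)"
  using fptime_If_Leaf [OF assms(1) [unfolded ptest_def] assms(2,3)] by simp

lemma ptest_not_Leaf: "polytime f \<Longrightarrow> ptest (\<lambda>t. f t \<noteq> Leaf)"
  unfolding ptest_def bool_tree_def by (intro fptime_If_Leaf fptime_const)

lemma ptest_const: "ptest (\<lambda>_. b)"
  unfolding ptest_def by (rule fptime_const)

lemma ptest_if:
  assumes "ptest P" "ptest Q" "ptest R"
  shows "ptest (\<lambda>t. if P t then Q t else R t)"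
proof -
  have "polytime (\<lambda>t. if P t then bool_tree (Q t) else bool_tree (R t))"
    using assms(2,3) by (intro polytime_If assms) (simp_all add: ptest_def)
  then show ?thesis unfolding ptest_def by (simp add: if_distrib [of bool_tree])
qed

lemma ptest_not: "ptest P \<Longrightarrow> ptest (\<lambda>t. \<not> P t)"
  using ptest_if [of P "\<lambda>_. False" "\<lambda>_. True"] by (simp add: ptest_const if_bool_eq_conj)

lemma ptest_conj: "ptest P \<Longrightarrow> ptest Q \<Longrightarrow> ptest (\<lambda>t. P t \<and> Q t)"
  using ptest_if [of P Q "\<lambda>_. False"] by (simp add: ptest_const if_bool_eq_disj)

lemma ptest_eq:
  assumes "ptest P" "ptest Q"
  shows "ptest (\<lambda>t. P t = Q t)"
proof -
  have "(\<lambda>t. P t = Q t) = (\<lambda>t. if P t then Q t else \<not> Q t)" by auto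
  then show ?thesis using ptest_if [OF assms ptest_not [OF assms(2)]] by simp
qed

lemma plist_if:
  assumes "ptest P" "plist F" "plist G"
  shows "plist (\<lambda>t. if P t then F t else G t)"
  using polytime_If [OF assms [unfolded plist_def]]
  unfolding plist_def by (simp add: if_distrib [of list_tree])

lemma plist_const: "plist (\<lambda>_. xs)"
  unfolding plist_def by (rule fptime_const)

lemma plist_Cons: "polytime f \<Longrightarrow> plist F \<Longrightarrow> plist (\<lambda>t. f t # F t)"
  unfolding plist_def list_tree.simps by (rule fptime_Node)

lemma polytime_fold:
  assumes "plist F" "polytime a" "polytime (\<lambda>u. h (left u) (left (right u)) (right (right u)))"
    and "polytime (\<lambda>u. g (left u) (right u))"
    and "\<And>t y acc. tree_size (h t y acc) \<le> tree_size acc + tree_size (g t y)"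
  shows "polytime (\<lambda>t. foldl (\<lambda>acc y. h t y acc) (a t) (F t))"
  using fptime_fold [OF assms(3) polytime_list_tree [OF assms(1)] assms(2,4,5)] by simp

text \<open>A loop can only push in front and so reverses its list. With reversal available, the
  constructions below fold over the reversed list and keep the order.\<close>

lemma plist_rev:
  assumes "plist F"
  shows "plist (\<lambda>t. rev (F t))"
proof -
  have "polytime (\<lambda>t. foldl (\<lambda>acc y. Node y acc) Leaf (F t))"
    by (rule polytime_fold [where h = "\<lambda>t y acc. Node y acc" and g = "\<lambda>t y. Node y Leaf"])
      (auto intro!: fptime_Node fptime_left fptime_right fptime_id fptime_const assms)
  moreover have "foldl (\<lambda>acc y. Node y acc) (list_tree as) xs = list_tree (rev xs @ as)" for xs as
    by (induction xs arbitrary: as) (auto simp flip: list_tree.simps)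
  from this [of "[]"] have "foldl (\<lambda>acc y. Node y acc) Leaf xs = list_tree (rev xs)" for xs
    by simp
  ultimately show ?thesis by (simp add: plist_def)
qed

lemma plist_append:
  assumes "plist F" "plist G"
  shows "plist (\<lambda>t. F t @ G t)"
proof -
  have "polytime (\<lambda>t. foldl (\<lambda>acc y. Node y acc) (list_tree (G t)) (rev (F t)))"
    by (rule polytime_fold [where h = "\<lambda>t y acc. Node y acc" and g = "\<lambda>t y. Node y Leaf"])
      (auto intro!: fptime_Node fptime_left fptime_right fptime_id fptime_const plist_rev
        polytime_list_tree assms)
  moreover have "foldl (\<lambda>acc y. Node y acc) (list_tree as) xs = list_tree (rev xs @ as)" for xs as
    by (induction xs arbitrary: as) (auto simp flip: list_tree.simps)
  ultimately show ?thesis by (simp add: plist_def)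
qed

lemma plist_map:
  assumes "plist F" "polytime (\<lambda>u. f (left u) (right u))"
  shows "plist (\<lambda>t. map (f t) (F t))"
proof -
  have "polytime (\<lambda>t. foldl (\<lambda>acc y. Node (f t y) acc) Leaf (rev (F t)))"
  proof (rule polytime_fold [where h = "\<lambda>t y acc. Node (f t y) acc" and g = "\<lambda>t y. Node (f t y) Leaf"])
    have "polytime (\<lambda>u. Node (left u) (left (right u)))"
      by (intro fptime_Node fptime_left fptime_right fptime_id)
    from fptime_comp [OF assms(2) this]
    show "polytime (\<lambda>u. Node (f (left u) (left (right u))) (right (right u)))"
      by (intro fptime_Node fptime_right fptime_id) simp
  qed (auto intro!: fptime_Node fptime_const plist_rev assms)
  moreover have "foldl (\<lambda>acc y. Node (g y) acc) (list_tree as) xs = list_tree (rev (map g xs) @ as)"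
    for xs as and g :: "tree \<Rightarrow> tree"
    by (induction xs arbitrary: as) (auto simp flip: list_tree.simps)
  from this [of _ "[]"]
  have "foldl (\<lambda>acc y. Node (g y) acc) Leaf xs = list_tree (rev (map g xs))" for xs and g :: "tree \<Rightarrow> tree"
    by simp
  ultimately show ?thesis by (simp add: plist_def rev_map)
qed

lemma plist_filter:
  assumes "plist F" "ptest (\<lambda>u. P (left u) (right u))"
  shows "plist (\<lambda>t. filter (P t) (F t))"
proof -
  have "polytime (\<lambda>t. foldl (\<lambda>acc y. if P t y then Node y acc else acc) Leaf (rev (F t)))"
  proof (rule polytime_fold [where h = "\<lambda>t y acc. if P t y then Node y acc else acc" and g = "\<lambda>t y. Node y Leaf"])
    have "polytime (\<lambda>u. Node (left u) (left (right u)))"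
      by (intro fptime_Node fptime_left fptime_right fptime_id)
    from ptest_comp [OF assms(2) this]
    show "polytime (\<lambda>u. if P (left u) (left (right u)) then Node (left (right u)) (right (right u))
        else right (right u))"
      by (intro polytime_If fptime_Node fptime_left fptime_right fptime_id) simp
  qed (auto intro!: fptime_Node fptime_const fptime_right fptime_id plist_rev assms)
  moreover have "foldl (\<lambda>acc y. if Q y then Node y acc else acc) (list_tree as) xs =
      list_tree (rev (filter Q xs) @ as)" for xs as and Q :: "tree \<Rightarrow> bool"
    by (induction xs arbitrary: as) (auto simp flip: list_tree.simps)
  from this [of _ "[]"]
  have "foldl (\<lambda>acc y. if Q y then Node y acc else acc) Leaf xs = list_tree (rev (filter Q xs))" for xs and Q :: "tree \<Rightarrow> bool"
    by simp
  ultimately show ?thesis by (simp add: plist_def rev_filter)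
qed

lemma tree_size_append: "tree_size (list_tree (xs @ ys)) + 1 = tree_size (list_tree xs) + tree_size (list_tree ys)"
  by (induction xs) auto

lemma plist_concat_map:
  assumes "plist F" "plist (\<lambda>u. G (left u) (right u))"
  shows "plist (\<lambda>t. concat (map (G t) (F t)))"
proof -
  have "polytime (\<lambda>t. foldl (\<lambda>acc y. list_tree (G t y @ lst acc)) Leaf (rev (F t)))"
  proof (rule polytime_fold [where h = "\<lambda>t y acc. list_tree (G t y @ lst acc)" and g = "\<lambda>t y. list_tree (G t y)"])
    have "polytime (\<lambda>u. Node (left u) (left (right u)))"
      by (intro fptime_Node fptime_left fptime_right fptime_id)
    from plist_comp [OF assms(2) this]
    show "polytime (\<lambda>u. list_tree (G (left u) (left (right u)) @ lst (right (right u))))"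
      by (intro polytime_list_tree plist_append plist_lst fptime_right fptime_id) simp
    show "tree_size (list_tree (G t y @ lst acc)) \<le> tree_size acc + tree_size (list_tree (G t y))" for t y acc
      using tree_size_append [of "G t y" "lst acc"] by simp
  qed (auto intro!: fptime_const plist_rev polytime_list_tree assms)
  moreover have "foldl (\<lambda>acc y. list_tree (H y @ lst acc)) (list_tree as) xs =
      list_tree (concat (map H (rev xs)) @ as)" for xs as and H :: "tree \<Rightarrow> tree list"
    by (induction xs arbitrary: as) auto
  from this [of _ "[]"]
  have "foldl (\<lambda>acc y. list_tree (H y @ lst acc)) Leaf xs = list_tree (concat (map H (rev xs)))" for xs and H :: "tree \<Rightarrow> tree list"
    by simp
  ultimately show ?thesis by (simp add: plist_def)
qed

lemma ptest_Bex:
  assumes "plist F" "ptest (\<lambda>u. P (left u) (right u))"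
  shows "ptest (\<lambda>t. \<exists>y\<in>set (F t). P t y)"
proof -
  have "(\<lambda>t. \<exists>y\<in>set (F t). P t y) = (\<lambda>t. list_tree (filter (P t) (F t)) \<noteq> Leaf)"
    by (auto simp: filter_empty_conv)
  then show ?thesis
    using ptest_not_Leaf [OF polytime_list_tree [OF plist_filter [OF assms]]] by simp
qed

lemma ptest_Ball:
  assumes "plist F" "ptest (\<lambda>u. P (left u) (right u))"
  shows "ptest (\<lambda>t. \<forall>y\<in>set (F t). P t y)"
  using ptest_not [OF ptest_Bex [where P = "\<lambda>t y. \<not> P t y", OF assms(1) ptest_not [OF assms(2)]]]
  by simp

text \<open>Numbers are handled as lengths of lists. Removing one cell of \<open>G t\<close> per
  cell of \<open>F t\<close> gives indexing and, by testing the rest for emptiness,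
  comparison.\<close>

lemma plist_drop:
  assumes "plist F" "plist G"
  shows "plist (\<lambda>t. drop (length (F t)) (G t))"
proof -
  have "polytime (\<lambda>t. foldl (\<lambda>acc y. right acc) (list_tree (G t)) (F t))"
    by (rule polytime_fold [where h = "\<lambda>t y acc. right acc" and g = "\<lambda>t y. y"])
      (auto intro!: fptime_right fptime_id polytime_list_tree assms trans_le_add1 tree_size_right)
  moreover have "foldl (\<lambda>acc y. right acc) (list_tree as) xs = list_tree (drop (length xs) as)"
    for xs :: "tree list" and as
    by (induction xs arbitrary: as) (auto simp: drop_Suc)
  ultimately show ?thesis by (simp add: plist_def)
qed

lemma ptest_length_less:
  assumes "plist F" "plist G"
  shows "ptest (\<lambda>t. length (F t) < length (G t))"
  using ptest_not_Leaf [OF polytime_list_tree [OF plist_drop [OF assms]]] by (simp add: not_le)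

lemma ptest_odd_length:
  assumes "plist F"
  shows "ptest (\<lambda>t. odd (length (F t)))"
proof -
  let ?h = "\<lambda>acc. if acc \<noteq> Leaf then Leaf else bool_tree True"
  have "polytime (\<lambda>t. foldl (\<lambda>acc y. ?h acc) Leaf (F t))"
    by (rule polytime_fold [where h = "\<lambda>t y acc. ?h acc" and g = "\<lambda>t y. bool_tree True"])
      (auto intro!: fptime_If_Leaf fptime_right fptime_id fptime_const assms simp: bool_tree_def)
  moreover have "foldl (\<lambda>acc y. ?h acc) (bool_tree b) xs = bool_tree (b \<noteq> odd (length xs))"
    for xs :: "tree list" and b
  proof (induction xs arbitrary: b)
    case (Cons y ys)
    have "?h (bool_tree b) = bool_tree (\<not> b)" by (simp add: bool_tree_def)
    then have "foldl (\<lambda>acc y. ?h acc) (bool_tree b) (y # ys) = bool_tree ((\<not> b) \<noteq> odd (length ys))"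
      by (simp only: foldl.simps Cons)
    then show ?case by (simp only: length_Cons even_Suc) (cases b; simp)
  qed simp
  from this [of False] have "foldl (\<lambda>acc y. ?h acc) Leaf xs = bool_tree (odd (length xs))"
    for xs :: "tree list" by (simp add: bool_tree_def)
  ultimately show ?thesis by (simp add: ptest_def)
qed

text \<open>There is no test for equality of trees, but one for equality of the bit strings they encode.\<close>

definition bits :: "tree \<Rightarrow> bool list" where
  "bits t = map (\<lambda>b. b \<noteq> Leaf) (lst t)"

lemma ptest_bits_eq:
  assumes "polytime f" "polytime g"
  shows "ptest (\<lambda>t. bits (f t) = bits (g t))"
proof -
  \<comment> \<open>The left part of the accumulator flags failure, the right part is what remains
    of the second string. A mismatch or an exhausted second string sets the flag and clears the
    rest, which makes failure permanent.\<close>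
  let ?h = "\<lambda>y acc. if right acc \<noteq> Leaf \<and> ((y \<noteq> Leaf) = (left (right acc) \<noteq> Leaf))
    then Node (left acc) (right (right acc)) else Node (Node Leaf Leaf) Leaf"
  have h: "polytime (\<lambda>t. foldl (\<lambda>acc y. ?h y acc) (Node Leaf (g t)) (lst (f t)))"
  proof (rule polytime_fold [where h = "\<lambda>t. ?h" and g = "\<lambda>t y. list_tree [Leaf, Leaf, Leaf]"])
    show "tree_size (?h y acc) \<le> tree_size acc + tree_size (list_tree [Leaf, Leaf, Leaf])" for y acc
      using tree_size_right [of "right acc"] by (cases acc) auto
    show "polytime (\<lambda>u. ?h (left (right u)) (right (right u)))"
      by (intro polytime_If ptest_conj ptest_not_Leaf ptest_eq fptime_Node fptime_left fptime_right
        fptime_id fptime_const)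
  qed (intro plist_lst fptime_Node fptime_const assms)+
  let ?good = "\<lambda>acc. left acc = Leaf \<and> right acc = Leaf"
  have "?good (foldl (\<lambda>acc y. ?h y acc) (Node b (list_tree ys)) xs) \<longleftrightarrow>
      b = Leaf \<and> bits (list_tree xs) = bits (list_tree ys)" for b xs ys
  proof (induction xs arbitrary: b ys)
    case (Cons x xs)
    show ?case
    proof (cases ys)
      case Nil
      with Cons [of "Node Leaf Leaf" "[]"] show ?thesis by (simp add: bits_def)
    next
      case [simp]: (Cons z zs)
      show ?thesis
        using Cons.IH [of "Node Leaf Leaf" "[]"] Cons.IH [of b zs] by (simp add: bits_def)
    qed
  qed (auto simp: bits_def)
  from this [of Leaf "lst _" "lst _"]
  have good: "?good (foldl (\<lambda>acc y. ?h y acc) (Node Leaf (g t)) (lst (f t))) \<longleftrightarrow> bits (f t) = bits (g t)" for t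
    by simp
  have "ptest (\<lambda>t. \<not> left (foldl (\<lambda>acc y. ?h y acc) (Node Leaf (g t)) (lst (f t))) \<noteq> Leaf \<and>
      \<not> right (foldl (\<lambda>acc y. ?h y acc) (Node Leaf (g t)) (lst (f t))) \<noteq> Leaf)"
    by (intro ptest_conj ptest_not ptest_not_Leaf fptime_left fptime_right h)
  then show ?thesis unfolding not_not good .
qed

lemmas polytime_basic =
  fptime_id fptime_const fptime_left fptime_right fptime_Node polytime_If polytime_list_tree
  ptest_const ptest_not ptest_conj ptest_eq ptest_Bex ptest_Ball ptest_not_Leaf
  ptest_length_less ptest_odd_length ptest_bits_eq
  plist_const plist_Cons plist_append plist_map plist_filter plist_concat_map plist_drop plist_lst plist_if

section \<open>Bounded guessing\<close>

primrec bits_val :: "bool list \<Rightarrow> nat" where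
  "bits_val [] = 0"
| "bits_val (b # bs) = of_bool b + 2 * bits_val bs"

lemma bits_val_nat_bits [simp]: "bits_val (nat_bits n) = n"
  by (induction n rule: nat_bits.induct) (subst nat_bits.simps, auto simp: of_bool_odd_eq_mod_2)

lemma bits_nat_tree [simp]: "bits (nat_tree n) = nat_bits n"
  by (simp add: bits_def nat_tree_def comp_def)

lemma length_nat_bits: "length (nat_bits n) \<le> n"
proof (induction n rule: nat_bits.induct)
  case (1 n)
  then show ?case by (cases "n = 0"; subst nat_bits.simps) fastforce+
qed

lemma length_lst_nat_tree: "length (lst (nat_tree n)) \<le> n"
  by (simp add: nat_tree_def length_nat_bits)

lemma nat_bits_eq_iff [simp]: "nat_bits m = nat_bits n \<longleftrightarrow> m = n"
  by (metis bits_val_nat_bits)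

lemma nat_bits_power2: "nat_bits (2 ^ j) = replicate j False @ [True]"
proof (induction j)
  case 0
  have "nat_bits 0 = []" by (subst nat_bits.simps) simp
  then show ?case by (subst nat_bits.simps) simp
qed (subst nat_bits.simps, simp)

text \<open>Horner's scheme from the most significant digit: doubling is concatenation with itself,
  and the value of the number becomes the length of a list.\<close>

definition unary :: "tree \<Rightarrow> tree" where
  "unary t = foldl (\<lambda>acc y. list_tree (lst acc @ lst acc @ (if y \<noteq> Leaf then [Leaf] else []))) Leaf
     (rev (lst t))"

lemma length_unary: "length (lst (unary t)) = bits_val (bits t)"
proof -
  have "length (lst (foldl (\<lambda>acc y. list_tree (lst acc @ lst acc @ (if y \<noteq> Leaf then [Leaf] else [])))
      Leaf (rev ys))) = bits_val (bits (list_tree ys))" for ys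
    by (induction ys) (auto simp: bits_def)
  from this [of "lst t"] show ?thesis by (simp add: unary_def)
qed

lemma length_unary_nat_tree [simp]: "length (lst (unary (nat_tree n))) = n"
  by (simp add: length_unary)

lemma fptime_unary: "fptime (\<lambda>t. length (lst t)) unary"
proof -
  let ?h = "\<lambda>y acc. list_tree (lst acc @ lst acc @ (if y \<noteq> Leaf then [Leaf] else []))"
  have *: "fptime (\<lambda>t. length (lst t)) (\<lambda>t. foldl (\<lambda>acc y. ?h y acc) Leaf (lst (list_tree (rev (lst t)))))"
  proof (rule fptime_fold_exponential)
    show "polytime (\<lambda>u. ?h (left u) (right u))"
      by (intro polytime_basic)
    show "tree_size (?h y acc) \<le> 3 * tree_size acc" for y acc
    proof -
      let ?z = "if y \<noteq> Leaf then [Leaf] else []"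
      \<comment> \<open>Each concatenation saves one \<open>Leaf\<close>, so an accumulator of size
        s grows to at most 2 s + 1, which is at most 3 s.\<close>
      have "tree_size (list_tree ?z) \<le> 3" by simp
      then show ?thesis
        using tree_size_append [of "lst acc" "lst acc @ ?z"] tree_size_append [of "lst acc" ?z]
          tree_size_pos [of acc] unfolding list_tree_lst by linarith
    qed
    have "polytime (\<lambda>t. list_tree (rev (lst t)))"
      by (intro polytime_list_tree plist_rev plist_lst fptime_id)
    then show "fptime (\<lambda>t. length (lst t)) (\<lambda>t. list_tree (rev (lst t)))"
      by (rule fptime_mono) simp
  qed (simp_all add: fptime_const)
  then show ?thesis
    unfolding unary_def lst_list_tree .
qed

section \<open>Enumeration of all words of a given length\<close>

definition words :: "tree list \<Rightarrow> tree \<Rightarrow> tree" where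
  "words L u =
     foldl (\<lambda>W _. list_tree (concat (map (\<lambda>l. map (Node l) (lst W)) L))) (list_tree [Leaf]) (lst u)"

lemma set_words:
  "set (lst (words L u)) = list_tree ` {ls. length ls = length (lst u) \<and> set ls \<subseteq> set L}"
proof -
  let ?h = "\<lambda>W. list_tree (concat (map (\<lambda>l. map (Node l) (lst W)) L))"
  have "set (lst (foldl (\<lambda>W _. ?h W) (list_tree [Leaf]) ys)) =
      list_tree ` {ls. length ls = length ys \<and> set ls \<subseteq> set L}" for ys :: "tree list"
  proof (induction ys rule: rev_induct)
    case (snoc y ys)
    have "list_tree ` {ls. length ls = Suc n \<and> set ls \<subseteq> set L} =
        (\<Union>l\<in>set L. Node l ` list_tree ` {ls. length ls = n \<and> set ls \<subseteq> set L})" for n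
    proof -
      have "{ls. length ls = Suc n \<and> set ls \<subseteq> set L} =
          (\<Union>l\<in>set L. (#) l ` {ls. length ls = n \<and> set ls \<subseteq> set L})"
        by (auto simp: length_Suc_conv image_iff)
      then show ?thesis by (simp add: image_UN image_image)
    qed
    with snoc show ?case by simp
  qed auto
  then show ?thesis by (simp add: words_def)
qed

text \<open>Each round multiplies the size by a factor that depends on the alphabet \<open>L\<close>
  only. As \<open>L\<close> is part of the program, this factor ends up in the degree of the
  polynomial and not in the parameter.\<close>

lemma fptime_words: "fptime (\<lambda>u. length (lst u)) (words L)"
proof -
  let ?h = "\<lambda>W. list_tree (concat (map (\<lambda>l. map (Node l) (lst W)) L))"
  have "fptime (\<lambda>u. length (lst u)) (\<lambda>u. foldl (\<lambda>W y. ?h W) (list_tree [Leaf]) (lst u))"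
  proof (rule fptime_fold_exponential)
    show "polytime (\<lambda>u. ?h (right u))"
      by (intro polytime_basic)
    have map: "tree_size (list_tree (map (Node l) ws)) \<le> (2 + tree_size l) * tree_size (list_tree ws)" for l ws
      by (induction ws) (auto simp: algebra_simps)
    show "tree_size (?h W) \<le> (1 + sum_list (map (\<lambda>l. 2 + tree_size l) L)) * tree_size W" for W
    proof (induction L)
      case (Cons l L)
      then show ?case
        using map [of l "lst W"] tree_size_append [of "map (Node l) (lst W)" "concat (map (\<lambda>l. map (Node l) (lst W)) L)"]
        by (simp add: algebra_simps)
    qed (simp add: Suc_le_eq)
  qed (simp_all add: fptime_const fptime_id)
  then show ?thesis unfolding words_def .
qed

lemma computes_runs:
  assumes "computes p f T"
  shows "\<exists>n. runs p t n (f t) \<and> n \<le> T t"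
proof -
  have "\<exists>n s'. exec p s n s' \<and> s' 0 = f (s 0) \<and> s' 1 = s 1 \<and> n \<le> T (s 0)" for s
    using assms unfolding computes_def by blast
  from this [of "(\<lambda>_. Leaf)(0 := t)"] show ?thesis
    unfolding runs_def by auto
qed

text \<open>In binary, a power of two is a block of zeros followed by a one, so the value is written
  down from the unary exponent without arithmetic. Time bounds are rounded up to such
  powers.\<close>

lemma computable_power2: "computable (\<lambda>k. 2 ^ (m * k + b))"
proof -
  let ?g = "\<lambda>u. list_tree (concat (map (\<lambda>_. replicate m Leaf) (lst u)) @ replicate b Leaf @ [Node Leaf Leaf])"
  have "polytime ?g" by (intro polytime_basic)
  from fptime_comp [OF this fptime_unary] obtain p q where
    p: "computes p (\<lambda>t. ?g (unary t)) q" by (rule fptimeE) blast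
  have rep: "concat (map (\<lambda>_. replicate m Leaf) xs) = replicate (m * length xs) Leaf" for xs :: "tree list"
    by (induction xs) (auto simp: replicate_add)
  have "?g (unary (nat_tree k)) = nat_tree (2 ^ (m * k + b))" for k
    by (simp add: rep nat_tree_def [of "2 ^ _"] nat_bits_power2 replicate_add bool_tree_def)
  moreover have "\<exists>n. runs p t n (?g (unary t))" for t
    using computes_runs [OF p] by blast
  ultimately show ?thesis
    unfolding computable_def by metis
qed

text \<open>The parameter bounds the length of the words, so there are few enough of them to check them all.\<close>

theorem fixed_parameter_tractable_guess:
  assumes U: "fptime \<kappa> U" and len: "\<And>t. length (lst (U t)) \<le> \<kappa> t"
    and chk: "ptest (\<lambda>u. chk (left u) (right u))"
    and \<kappa>: "\<And>i t. is_instance P i \<Longrightarrow> t \<in> encodings P i \<Longrightarrow> \<kappa> t \<le> a * parameter P i"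
    and ans: "\<And>i t. is_instance P i \<Longrightarrow> t \<in> encodings P i \<Longrightarrow> answer P i \<longleftrightarrow>
      (\<exists>ls. length ls = length (lst (U t)) \<and> set ls \<subseteq> set L \<and> chk t (list_tree ls))"
  shows "fixed_parameter_tractable P"
proof -
  define f where "f t = bool_tree (\<exists>w\<in>set (lst (words L (U t))). chk t w)" for t
  have "fptime \<kappa> (\<lambda>t. words L (U t))"
    by (rule fptime_comp' [OF U fptime_words len])
  then have g: "fptime \<kappa> (\<lambda>t. Node t (words L (U t)))"
    by (intro fptime_Node fptime_id)
  have "polytime (\<lambda>u. Node (left (left u)) (right u))"
    by (intro polytime_basic)
  from ptest_comp [OF chk this] have "ptest (\<lambda>u. chk (left (left u)) (right u))" by simp
  then have "ptest (\<lambda>u. \<exists>w\<in>set (lst (right u)). chk (left u) w)"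
    by (intro polytime_basic)
  from fptime_comp [OF this [unfolded ptest_def] g] have "fptime \<kappa> f"
    unfolding f_def by simp
  then obtain p q where q: "poly_bounded q" and p: "computes p f (\<lambda>t. q (2 ^ \<kappa> t * tree_size t))"
    by (rule fptimeE) blast
  obtain C d where q': "\<And>n. n > 0 \<Longrightarrow> q n \<le> C * n ^ d"
    using q by (auto simp: poly_bounded_def)
  show ?thesis
    unfolding fixed_parameter_tractable_def
  proof (rule exI, rule exI, rule exI, intro conjI allI impI ballI)
    \<comment> \<open>The time is at most \<open>C * (2 ^ (a * k) * n) ^ d\<close> for parameter
      \<open>k\<close> and size \<open>n\<close>; replacing \<open>C\<close> by \<open>2 ^ C\<close>
      turns the factor in \<open>k\<close> into a power of two.\<close>
    show "computable (\<lambda>k. 2 ^ (a * d * k + C))" by (rule computable_power2)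
    fix i t assume i: "is_instance P i" "t \<in> encodings P i"
    let ?k = "parameter P i"
    obtain n where s: "runs p t n (f t)" "n \<le> q (2 ^ \<kappa> t * tree_size t)"
      using computes_runs [OF p] by blast
    have "f t = bool_tree (answer P i)"
      using ans [OF i] by (auto simp: f_def set_words)
    with s(1) have "runs p t n (bool_tree (answer P i))" by simp
    moreover have "n \<le> 2 ^ (a * d * ?k + C) * tree_size t ^ d"
    proof -
      note s(2)
      also have "q (2 ^ \<kappa> t * tree_size t) \<le> C * (2 ^ \<kappa> t * tree_size t) ^ d"
        by (rule q') simp
      also have "\<dots> \<le> 2 ^ C * (2 ^ (a * ?k) * tree_size t) ^ d"
        using \<kappa> [OF i]
        by (intro mult_mono power_mono mult_right_mono power_increasing) (auto intro: less_imp_le less_exp)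
      also have "\<dots> = 2 ^ (a * d * ?k + C) * tree_size t ^ d"
        by (simp add: power_mult_distrib power_add power_mult [symmetric] mult.commute mult.left_commute)
      finally show ?thesis .
    qed
    ultimately show "\<exists>n. runs p t n (bool_tree (answer P i)) \<and>
        n \<le> 2 ^ (a * d * ?k + C) * tree_size t ^ d" by blast
  qed
qed

section \<open>The search tree\<close>

text \<open>
  A tree \<open>E\<close> represents the set of the arguments that occur an odd number of times in the list
  \<open>lst E\<close>, so that adding or removing an argument is one and the same operation, \<open>Node\<close>.
\<close>

definition odd_member :: "tree \<Rightarrow> tree \<Rightarrow> bool" where
  "odd_member E x \<longleftrightarrow> odd (length (filter (\<lambda>y. bits y = bits x) (lst E)))"

definition attackers :: "tree \<Rightarrow> tree \<Rightarrow> tree list" where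
  "attackers A x = map left (filter (\<lambda>p. bits (right p) = bits x) (lst A))"

text \<open>The arguments on which a constraint can depend, as a list to be indexed by a letter.
  Repetitions only waste letters.\<close>

definition vicinity :: "tree \<Rightarrow> tree \<Rightarrow> tree list" where
  "vicinity A x = x # attackers A x @ concat (map (attackers A) (attackers A x))"

text \<open>The arguments of \<open>\<beta>\<close> tell whether \<open>x\<close> is in \<open>E\<close>, attacked by \<open>E\<close>, and defended by \<open>E\<close>.\<close>

definition locally_ok :: "(bool \<Rightarrow> bool \<Rightarrow> bool \<Rightarrow> bool) \<Rightarrow> tree \<Rightarrow> tree \<Rightarrow> tree \<Rightarrow> bool" where
  "locally_ok \<beta> A E x \<longleftrightarrow> \<beta> (odd_member E x) (\<exists>y\<in>set (attackers A x). odd_member E y)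
     (\<forall>y\<in>set (attackers A x). \<exists>z\<in>set (attackers A y). odd_member E z)"

definition violations :: "(bool \<Rightarrow> bool \<Rightarrow> bool \<Rightarrow> bool) \<Rightarrow> tree \<Rightarrow> tree \<Rightarrow> tree \<Rightarrow> tree list" where
  "violations \<beta> X A E = filter (\<lambda>x. \<not> locally_ok \<beta> A E x) (lst X)"

text \<open>The letter \<open>l\<close>, a number in unary notation, selects the argument that is flipped.\<close>

definition step :: "(bool \<Rightarrow> bool \<Rightarrow> bool \<Rightarrow> bool) \<Rightarrow> tree \<Rightarrow> tree \<Rightarrow> tree \<Rightarrow> tree \<Rightarrow> tree" where
  "step \<beta> X A E l =
     (if list_tree (violations \<beta> X A E) \<noteq> Leaf
      then Node (left (list_tree (drop (length (lst l))
             (vicinity A (left (list_tree (violations \<beta> X A E))))))) E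
      else E)"

text \<open>Once nothing is violated the walk stands still, so words longer than needed are
  harmless. A letter out of range selects \<open>Leaf\<close>, the code of 0, perhaps not an
  argument at all; this is harmless too, since the final set is checked in any case.\<close>

definition walk :: "(bool \<Rightarrow> bool \<Rightarrow> bool \<Rightarrow> bool) \<Rightarrow> tree \<Rightarrow> tree \<Rightarrow> tree \<Rightarrow> tree \<Rightarrow> tree" where
  "walk \<beta> X A E w = foldl (step \<beta> X A) E (lst w)"

definition difference :: "tree \<Rightarrow> tree \<Rightarrow> tree \<Rightarrow> tree list" where
  "difference X E E' = filter (\<lambda>x. odd_member E x \<noteq> odd_member E' x) (lst X)"

text \<open>The accumulator pairs the unread part of the word with the current set. One letter is
  consumed per element of \<open>D\<close>, and the letters left over are returned for the walk that
  follows.\<close>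

definition select :: "tree list \<Rightarrow> tree \<Rightarrow> tree \<Rightarrow> tree" where
  "select D w E = foldl (\<lambda>acc y. Node (right (left acc))
     (if left (left acc) \<noteq> Leaf then Node y (right acc) else right acc)) (Node w E) D"

text \<open>An arbitrary Boolean function \<beta> comes without a program, but its eight values can
  be hard-wired as nested conditionals.\<close>

lemma ptest_bool3:
  assumes "ptest P" "ptest Q" "ptest R"
  shows "ptest (\<lambda>t. \<beta> (P t) (Q t) (R t))"
proof -
  have "(\<lambda>t. \<beta> (P t) (Q t) (R t)) = (\<lambda>t.
    if P t then if Q t then if R t then \<beta> True True True else \<beta> True True False
                else if R t then \<beta> True False True else \<beta> True False False
    else if Q t then if R t then \<beta> False True True else \<beta> False True False
         else if R t then \<beta> False False True else \<beta> False False False)"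
    (is "?l = ?r")
  proof
    show "?l t = ?r t" for t
      by (cases "P t"; cases "Q t"; cases "R t") simp_all
  qed
  then show ?thesis by (simp only:) (intro ptest_if ptest_const assms)
qed

section \<open>Polynomial time bounds for the operations of the search\<close>

lemma ptest_odd_member:
  assumes "polytime E" "polytime x"
  shows "ptest (\<lambda>t. odd_member (E t) (x t))"
  unfolding odd_member_def
  by (intro polytime_basic assms [THEN fptime_comp] assms)

lemma plist_attackers:
  assumes "polytime A" "polytime x"
  shows "plist (\<lambda>t. attackers (A t) (x t))"
  unfolding attackers_def
  by (intro polytime_basic assms [THEN fptime_comp] assms)

lemma plist_vicinity:
  assumes "polytime A" "polytime x"
  shows "plist (\<lambda>t. vicinity (A t) (x t))"
  unfolding vicinity_def
  by (intro polytime_basic plist_attackers assms [THEN fptime_comp] assms)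

lemma ptest_locally_ok:
  assumes "polytime A" "polytime E" "polytime x"
  shows "ptest (\<lambda>t. locally_ok \<beta> (A t) (E t) (x t))"
  unfolding locally_ok_def
  by (intro ptest_bool3 [of _ _ _ \<beta>] polytime_basic ptest_odd_member plist_attackers assms [THEN fptime_comp] assms)

lemma plist_violations:
  assumes "polytime X" "polytime A" "polytime E"
  shows "plist (\<lambda>t. violations \<beta> (X t) (A t) (E t))"
  unfolding violations_def
  by (intro polytime_basic ptest_locally_ok assms [THEN fptime_comp] assms)

lemma polytime_step:
  assumes "polytime X" "polytime A" "polytime E" "polytime l"
  shows "polytime (\<lambda>t. step \<beta> (X t) (A t) (E t) (l t))"
  unfolding step_def
  by (intro polytime_basic plist_violations plist_vicinity assms)

lemma tree_size_left_drop:
  assumes "\<forall>x\<in>set xs. tree_size x \<le> n" "0 < n"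
  shows "tree_size (left (list_tree (drop i xs))) \<le> n"
proof (cases "drop i xs")
  case (Cons y ys)
  then have "y \<in> set xs" by (metis in_set_dropD list.set_intros(1))
  with Cons assms show ?thesis by simp
qed (use assms in simp)

lemma tree_size_attackers: "y \<in> set (attackers A x) \<Longrightarrow> tree_size y \<le> tree_size A"
  unfolding attackers_def
  using tree_size_mem_lst tree_size_left by (fastforce intro: le_trans less_imp_le)

text \<open>The argument that is pushed occurs in \<open>X\<close> or in \<open>A\<close> (or is
  \<open>Leaf\<close>), so the growth does not depend on \<open>E\<close>. This is the additive
  growth that folds require.\<close>

lemma tree_size_step: "tree_size (step \<beta> X A E l) \<le> tree_size E + tree_size (Node X A)"
proof (cases "violations \<beta> X A E")
  case (Cons x xs)
  then have "x \<in> set (violations \<beta> X A E)" by simp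
  then have "x \<in> set (lst X)" by (simp add: violations_def)
  then have "\<forall>y\<in>set (vicinity A x). tree_size y \<le> tree_size X + tree_size A"
    by (auto simp: vicinity_def dest!: tree_size_mem_lst tree_size_attackers)
  from tree_size_left_drop [OF this] have
    "tree_size (left (list_tree (drop i (vicinity A x)))) \<le> tree_size X + tree_size A" for i by simp
  with Cons show ?thesis by (simp add: step_def)
qed (simp add: step_def)

lemma polytime_walk:
  assumes "polytime X" "polytime A" "polytime E" "polytime w"
  shows "polytime (\<lambda>t. walk \<beta> (X t) (A t) (E t) (w t))"
  unfolding walk_def
proof (rule polytime_fold [where h = "\<lambda>t y acc. step \<beta> (X t) (A t) acc y" and g = "\<lambda>t y. Node (X t) (A t)"])
  show "tree_size (step \<beta> (X t) (A t) acc y) \<le> tree_size acc + tree_size (Node (X t) (A t))" for t y acc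
    by (rule tree_size_step)
qed (intro polytime_basic polytime_step assms [THEN fptime_comp] assms)+

lemma plist_difference:
  assumes "polytime X" "polytime E" "polytime E'"
  shows "plist (\<lambda>t. difference (X t) (E t) (E' t))"
  unfolding difference_def
  by (intro polytime_basic ptest_odd_member assms [THEN fptime_comp] assms)

lemma polytime_select:
  assumes "plist D" "polytime w" "polytime E"
  shows "polytime (\<lambda>t. select (D t) (w t) (E t))"
proof -
  let ?h = "\<lambda>y acc. Node (right (left acc)) (if left (left acc) \<noteq> Leaf then Node y (right acc) else right acc)"
  show ?thesis
    unfolding select_def
  proof (rule polytime_fold [where h = "\<lambda>t. ?h" and g = "\<lambda>t y. Node (Node Leaf Leaf) y"])
    show "tree_size (?h y acc) \<le> tree_size acc + tree_size (Node (Node Leaf Leaf) y)" for y acc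
      using tree_size_right [of "left acc"] by (cases acc) auto
  qed (intro polytime_basic ptest_not_Leaf assms)+
qed

lemmas polytime_search =
  polytime_basic ptest_odd_member ptest_locally_ok polytime_walk plist_difference plist_violations polytime_select

section \<open>Extensions as solutions of local constraints\<close>

definition local_constraint ::
  "(bool \<Rightarrow> bool \<Rightarrow> bool \<Rightarrow> bool) \<Rightarrow> (nat \<times> nat) set \<Rightarrow> nat set \<Rightarrow> nat \<Rightarrow> bool" where
  "local_constraint \<beta> A E x \<longleftrightarrow> \<beta> (x \<in> E) (\<exists>y. (y, x) \<in> A \<and> y \<in> E)
     (\<forall>y. (y, x) \<in> A \<longrightarrow> (\<exists>z. (z, y) \<in> A \<and> z \<in> E))"

definition neighbourhood :: "(nat \<times> nat) set \<Rightarrow> nat \<Rightarrow> nat set" where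
  "neighbourhood A x = {x} \<union> {y. (y, x) \<in> A} \<union> {z. \<exists>y. (z, y) \<in> A \<and> (y, x) \<in> A}"

lemma local_constraint_cong:
  assumes "\<And>y. y \<in> neighbourhood A x \<Longrightarrow> y \<in> E \<longleftrightarrow> y \<in> E'"
  shows "local_constraint \<beta> A E x \<longleftrightarrow> local_constraint \<beta> A E' x"
proof -
  have "(x \<in> E) = (x \<in> E')" "(\<exists>y. (y, x) \<in> A \<and> y \<in> E) = (\<exists>y. (y, x) \<in> A \<and> y \<in> E')"
    "(\<forall>y. (y, x) \<in> A \<longrightarrow> (\<exists>z. (z, y) \<in> A \<and> z \<in> E)) =
     (\<forall>y. (y, x) \<in> A \<longrightarrow> (\<exists>z. (z, y) \<in> A \<and> z \<in> E'))"
    using assms unfolding neighbourhood_def by blast+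
  then show ?thesis unfolding local_constraint_def by simp
qed

lemma local_constraint_defended:
  assumes "is_af (X, A)"
  shows "local_constraint \<beta> A E x \<longleftrightarrow>
    \<beta> (x \<in> E) (\<exists>y\<in>E. (y, x) \<in> A) (defended (X, A) E x)"
proof -
  have "(\<exists>y. (y, x) \<in> A \<and> y \<in> E) \<longleftrightarrow> (\<exists>y\<in>E. (y, x) \<in> A)" by blast
  moreover have "(\<forall>y. (y, x) \<in> A \<longrightarrow> (\<exists>z. (z, y) \<in> A \<and> z \<in> E)) \<longleftrightarrow> defended (X, A) E x"
    using assms by (auto simp: is_af_def defended_def)
  ultimately show ?thesis by (simp add: local_constraint_def)
qed

text \<open>Conflict-freeness says that members are not attacked by the set. Admissibility adds that
  members are defended, completeness makes this an equivalence, and stability says that the members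
  are exactly the arguments not attacked by the set.\<close>

lemma extensions_local:
  assumes "\<sigma> \<in> {adm, com, stb}"
  obtains \<beta> where "\<And>X A E. is_af (X, A) \<Longrightarrow> E \<subseteq> X \<Longrightarrow>
    E \<in> \<sigma> (X, A) \<longleftrightarrow> (\<forall>x\<in>X. local_constraint \<beta> A E x)"
proof -
  have cf: "conflict_free (X, A) E \<longleftrightarrow> (\<forall>x\<in>E. \<not> (\<exists>y\<in>E. (y, x) \<in> A))"
    if "E \<subseteq> X" for X A and E :: "nat set"
    using that by (auto simp: conflict_free_def)
  consider "\<sigma> = adm" | "\<sigma> = com" | "\<sigma> = stb" using assms by blast
  then show ?thesis
  proof cases
    case 1
    show ?thesis
    proof (rule that [of "\<lambda>m a d. m \<longrightarrow> \<not> a \<and> d"])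
      fix X A and E :: "nat set" assume "is_af (X, A)" "E \<subseteq> X"
      then show "E \<in> \<sigma> (X, A) \<longleftrightarrow> (\<forall>x\<in>X. local_constraint (\<lambda>m a d. m \<longrightarrow> \<not> a \<and> d) A E x)"
        unfolding 1 adm_def mem_Collect_eq cf [OF \<open>E \<subseteq> X\<close>] local_constraint_defended [OF \<open>is_af (X, A)\<close>]
        by blast
    qed
  next
    case 2
    show ?thesis
    proof (rule that [of "\<lambda>m a d. (m \<longrightarrow> \<not> a) \<and> (m \<longleftrightarrow> d)"])
      fix X A and E :: "nat set" assume "is_af (X, A)" "E \<subseteq> X"
      then show "E \<in> \<sigma> (X, A) \<longleftrightarrow>
          (\<forall>x\<in>X. local_constraint (\<lambda>m a d. (m \<longrightarrow> \<not> a) \<and> (m \<longleftrightarrow> d)) A E x)"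
        unfolding 2 com_def adm_def mem_Collect_eq fst_conv cf [OF \<open>E \<subseteq> X\<close>]
          local_constraint_defended [OF \<open>is_af (X, A)\<close>]
        by blast
    qed
  next
    case 3
    show ?thesis
    proof (rule that [of "\<lambda>m a d. m \<longleftrightarrow> \<not> a"])
      fix X A and E :: "nat set" assume "is_af (X, A)" "E \<subseteq> X"
      moreover have "range_of (X, A) E = X \<longleftrightarrow> (\<forall>x\<in>X. x \<notin> E \<longrightarrow> (\<exists>y\<in>E. (y, x) \<in> A))"
        by (auto simp: range_of_def)
      ultimately show "E \<in> \<sigma> (X, A) \<longleftrightarrow> (\<forall>x\<in>X. local_constraint (\<lambda>m a d. m \<longleftrightarrow> \<not> a) A E x)"
        unfolding 3 stb_def mem_Collect_eq fst_conv cf [OF \<open>E \<subseteq> X\<close>]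
          local_constraint_defended [OF \<open>is_af (X, A)\<close>]
        by blast
    qed
  qed
qed

text \<open>The degree does not count \<open>x\<close> itself, so a self-attack may add one
  attacker.\<close>

lemma card_attackers:
  assumes "is_af (X, A)" "max_degree (X, A) \<le> c"
  shows "card {y. (y, x) \<in> A} \<le> Suc c"
proof (cases "x \<in> X")
  case True
  have X: "finite X" "A \<subseteq> X \<times> X" using assms(1) by (auto simp: is_af_def)
  let ?N = "{y \<in> X - {x}. (x, y) \<in> A \<or> (y, x) \<in> A}"
  have "card ?N \<le> max_degree (X, A)"
    unfolding max_degree_def using X True by (intro Max_ge) (auto simp: degree_def)
  moreover have "card {y. (y, x) \<in> A} \<le> card (insert x ?N)"
    using X by (intro card_mono) auto
  moreover have "card (insert x ?N) \<le> Suc (card ?N)" by (rule card_insert_le_m1) auto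
  ultimately show ?thesis using assms(2) by linarith
next
  case False
  then have "{y. (y, x) \<in> A} = {}" using assms(1) by (auto simp: is_af_def)
  then show ?thesis by (simp only: card.empty)
qed

section \<open>Correctness of the search\<close>

definition ext :: "tree \<Rightarrow> nat set" where
  "ext E = {n. odd_member E (nat_tree n)}"

lemma ext_Node [simp]: "ext (Node (nat_tree x) E) = sym_diff (ext E) {x}"
  by (auto simp: ext_def odd_member_def)

lemma ext_Leaf [simp]: "ext Leaf = {}"
  by (auto simp: ext_def odd_member_def)

lemma enc_set_lst:
  assumes "t \<in> enc_set f S"
  obtains xs where "distinct xs" "set xs = S" "list_all2 (\<lambda>t x. t \<in> f x) (lst t) xs"
  using assms by (auto simp: enc_set_def)

lemma list_all2_eq_map: "list_all2 (\<lambda>t x. t = g x) ts xs \<longleftrightarrow> ts = map g xs"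
  by (induction ts xs rule: list_induct2') auto

lemma enc_set_nat_lst:
  assumes "t \<in> enc_set enc_nat S"
  obtains xs where "distinct xs" "set xs = S" "lst t = map nat_tree xs"
  using assms by (elim enc_set_lst) (auto simp: enc_nat_def list_all2_eq_map)

lemma enc_set_attacks_lst:
  assumes "t \<in> enc_set (enc_pair enc_nat enc_nat) A"
  obtains as where "distinct as" "set as = A" "lst t = map (\<lambda>(a, b). Node (nat_tree a) (nat_tree b)) as"
proof -
  have "enc_pair enc_nat enc_nat p = {(\<lambda>(a, b). Node (nat_tree a) (nat_tree b)) p}" for p
    by (cases p) (auto simp: enc_pair_def enc_nat_def)
  with assms that show ?thesis
    by (elim enc_set_lst) (auto simp: list_all2_eq_map)
qed

text \<open>Encodings list a set without repetitions, so odd multiplicity is the same as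
  membership.\<close>

lemma ext_enc_set:
  assumes "t \<in> enc_set enc_nat S"
  shows "ext t = S"
proof -
  obtain xs where xs: "distinct xs" "set xs = S" "lst t = map nat_tree xs"
    using assms by (rule enc_set_nat_lst)
  have "odd (length (filter (\<lambda>y. y = n) xs)) \<longleftrightarrow> n \<in> set xs" for n
    using xs(1) by (induction xs) (auto simp: filter_empty_conv)
  with xs show ?thesis
    by (auto simp: ext_def odd_member_def filter_map comp_def)
qed

definition letters :: "nat \<Rightarrow> tree list" where
  "letters b = map (\<lambda>j. list_tree (replicate j Leaf)) [0..<b]"

lemma list_tree_replicate_letters: "j < b \<Longrightarrow> list_tree (replicate j Leaf) \<in> set (letters b)"
  by (auto simp: letters_def)

text \<open>One for the argument itself, \<open>c + 1\<close> for its attackers,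
  \<open>(c + 1) ^ 2\<close> for theirs. The value exceeds 1, so the letters 0 and 1 always
  exist.\<close>

definition branching :: "nat \<Rightarrow> nat" where
  "branching c = Suc (Suc c + Suc c * Suc c)"

locale encoded_af =
  fixes X :: "nat set" and A :: "(nat \<times> nat) set" and c :: nat and Xt At :: tree
  assumes af: "is_af (X, A)" and deg: "max_degree (X, A) \<le> c"
    and enc: "Node Xt At \<in> enc_af (X, A)"
begin

lemma finite_X: "finite X" and attacks: "A \<subseteq> X \<times> X"
  using af by (auto simp: is_af_def)

lemma lst_Xt:
  obtains xs where "distinct xs" "set xs = X" "lst Xt = map nat_tree xs"
  using enc by (auto simp: enc_af_def enc_pair_def elim: enc_set_nat_lst)

lemma attackers_nat_tree:
  obtains ys where "distinct ys" "set ys = {y. (y, x) \<in> A}" "attackers At (nat_tree x) = map nat_tree ys"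
proof -
  have "At \<in> enc_set (enc_pair enc_nat enc_nat) A"
    using enc by (auto simp: enc_af_def enc_pair_def)
  then obtain as where as: "distinct as" "set as = A"
    "lst At = map (\<lambda>(a, b). Node (nat_tree a) (nat_tree b)) as"
    by (rule enc_set_attacks_lst)
  let ?ys = "map fst (filter (\<lambda>p. snd p = x) as)"
  show ?thesis
  proof (rule that)
    show "distinct ?ys"
      using as(1) by (auto simp: distinct_map inj_on_def prod_eq_iff)
    show "set ?ys = {y. (y, x) \<in> A}"
      using as(2) by force
    show "attackers At (nat_tree x) = map nat_tree ?ys"
      by (simp add: attackers_def as(3) filter_map comp_def case_prod_beta)
  qed
qed

lemma set_attackers: "set (attackers At (nat_tree x)) = nat_tree ` {y. (y, x) \<in> A}"
  by (metis attackers_nat_tree list.set_map)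

lemma length_attackers: "length (attackers At (nat_tree x)) \<le> Suc c"
  by (metis attackers_nat_tree card_attackers [OF af deg] distinct_card length_map)

lemma set_vicinity: "set (vicinity At (nat_tree x)) = nat_tree ` neighbourhood A x"
  by (auto simp: vicinity_def set_attackers neighbourhood_def)

lemma length_vicinity: "length (vicinity At (nat_tree x)) \<le> branching c"
proof -
  obtain ys where ys: "attackers At (nat_tree x) = map nat_tree ys"
    by (rule attackers_nat_tree)
  have "length (concat (map (\<lambda>y. attackers At (nat_tree y)) ys)) \<le> length ys * Suc c" for ys
  proof (induction ys)
    case (Cons y ys)
    then show ?case using length_attackers [of y] by simp
  qed simp
  also have "length ys * Suc c \<le> Suc c * Suc c"
    using length_attackers [of x] unfolding ys by (intro mult_right_mono) auto
  finally show ?thesis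
    using length_attackers [of x] by (simp add: vicinity_def branching_def ys comp_def)
qed

lemma locally_ok_iff: "locally_ok \<beta> At E (nat_tree x) \<longleftrightarrow> local_constraint \<beta> A (ext E) x"
proof -
  have "(\<exists>y\<in>set (attackers At (nat_tree x)). odd_member E y) \<longleftrightarrow> (\<exists>y. (y, x) \<in> A \<and> y \<in> ext E)" for x
    by (auto simp: set_attackers ext_def)
  then show ?thesis
    by (simp add: locally_ok_def local_constraint_def) (simp add: set_attackers ext_def)
qed

lemma set_violations:
  "set (violations \<beta> Xt At E) = nat_tree ` {x \<in> X. \<not> local_constraint \<beta> A (ext E) x}"
proof -
  obtain xs where "set xs = X" "lst Xt = map nat_tree xs" by (rule lst_Xt)
  then show ?thesis by (auto simp: violations_def locally_ok_iff)
qed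

lemma length_difference:
  "length (difference Xt E E') = card {x \<in> X. (x \<in> ext E) \<noteq> (x \<in> ext E')}"
proof -
  obtain xs where xs: "distinct xs" "set xs = X" "lst Xt = map nat_tree xs"
    by (rule lst_Xt)
  then have "length (difference Xt E E') = length (filter (\<lambda>x. (x \<in> ext E) \<noteq> (x \<in> ext E')) xs)"
    by (simp add: difference_def filter_map comp_def ext_def)
  also have "\<dots> = card (set (filter (\<lambda>x. (x \<in> ext E) \<noteq> (x \<in> ext E')) xs))"
    using xs(1) by (simp only: distinct_card distinct_filter)
  also have "set (filter (\<lambda>x. (x \<in> ext E) \<noteq> (x \<in> ext E')) xs) = {x \<in> X. (x \<in> ext E) \<noteq> (x \<in> ext E')}"
    using xs by auto
  finally show ?thesis .
qed

text \<open>
  A violated constraint forces a solution to differ from the current set within the neighbourhood,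
  so that some letter brings the walk closer to the solution.
\<close>

lemma walk_reaches:
  assumes "\<forall>x\<in>X. local_constraint \<beta> A S x" "finite (sym_diff (ext E) S)"
    and "card (sym_diff (ext E) S) \<le> n"
  shows "\<exists>ls. length ls = n \<and> set ls \<subseteq> set (letters (branching c)) \<and>
    (\<forall>x\<in>X. local_constraint \<beta> A (ext (walk \<beta> Xt At E (list_tree ls))) x) \<and>
    ext E \<inter> S \<subseteq> ext (walk \<beta> Xt At E (list_tree ls)) \<and>
    ext (walk \<beta> Xt At E (list_tree ls)) \<subseteq> ext E \<union> S"
  using assms(2,3)
proof (induction n arbitrary: E)
  case 0
  then have "ext E = S" by auto
  with assms(1) show ?case by (simp add: walk_def)
next
  case (Suc n)
  show ?case
  proof (cases "violations \<beta> Xt At E")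
    case Nil
    then have "step \<beta> Xt At E l = E" for l by (simp add: step_def)
    then have "foldl (step \<beta> Xt At) E ls = E" for ls by (induction ls) auto
    then have "walk \<beta> Xt At E (list_tree ls) = E" for ls by (simp add: walk_def)
    moreover have "\<forall>x\<in>X. local_constraint \<beta> A (ext E) x"
      using set_violations [of \<beta> E] Nil by auto
    \<comment> \<open>The set is already a solution, so padding by the letter 0 brings the word to
      the prescribed length.\<close>
    moreover have "set (replicate (Suc n) (list_tree (replicate 0 Leaf))) \<subseteq> set (letters (branching c))"
      using list_tree_replicate_letters [of 0 "branching c"] set_replicate_Suc [of n]
      by (simp add: branching_def del: replicate_Suc)
    ultimately show ?thesis
      by (intro exI [of _ "replicate (Suc n) (list_tree (replicate 0 Leaf))"]) (simp del: replicate_Suc)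
  next
    case (Cons v vs)
    then have "v \<in> set (violations \<beta> Xt At E)" by simp
    then obtain x where x: "v = nat_tree x" "x \<in> X" "\<not> local_constraint \<beta> A (ext E) x"
      by (auto simp: set_violations)
    with assms(1) obtain y where y: "y \<in> neighbourhood A x" "y \<in> ext E \<longleftrightarrow> y \<notin> S"
      using local_constraint_cong [of A x "ext E" S \<beta>] by blast
    then obtain j where j: "j < length (vicinity At (nat_tree x))" "vicinity At (nat_tree x) ! j = nat_tree y"
      by (metis image_eqI in_set_conv_nth set_vicinity)
    let ?l = "list_tree (replicate j Leaf)"
    have l: "?l \<in> set (letters (branching c))"
      using j(1) length_vicinity [of x] by (intro list_tree_replicate_letters) linarith
    have step: "step \<beta> Xt At E ?l = Node (nat_tree y) E"
      using j x(1) Cons by (simp add: step_def Cons_nth_drop_Suc [symmetric])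
    have E': "sym_diff (ext (Node (nat_tree y) E)) S = sym_diff (ext E) S - {y}"
      "y \<in> sym_diff (ext E) S"
      using y(2) by auto
    have "finite (sym_diff (ext (Node (nat_tree y) E)) S)"
      "card (sym_diff (ext (Node (nat_tree y) E)) S) \<le> n"
      using Suc.prems E'(2) unfolding E'(1) by (auto simp: card_Diff_singleton)
    from Suc.IH [OF this] obtain ls where ls: "length ls = n" "set ls \<subseteq> set (letters (branching c))"
      "\<forall>x\<in>X. local_constraint \<beta> A (ext (walk \<beta> Xt At (Node (nat_tree y) E) (list_tree ls))) x"
      "ext (Node (nat_tree y) E) \<inter> S \<subseteq> ext (walk \<beta> Xt At (Node (nat_tree y) E) (list_tree ls))"
      "ext (walk \<beta> Xt At (Node (nat_tree y) E) (list_tree ls)) \<subseteq> ext (Node (nat_tree y) E) \<union> S"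
      by blast
    have walk: "walk \<beta> Xt At E (list_tree (?l # ls)) = walk \<beta> Xt At (Node (nat_tree y) E) (list_tree ls)"
      by (simp add: walk_def step)
    \<comment> \<open>The flip at \<open>y\<close> makes the set agree with \<open>S\<close> there,
      so it stays between \<open>ext E\<close> and \<open>S\<close>, and the inclusions for the rest
      of the walk give those for the whole.\<close>
    show ?thesis
      by (rule exI [of _ "?l # ls"], unfold walk) (use l ls y(2) in auto)
  qed
qed

text \<open>Attackers lie in \<open>X\<close>, so elements outside \<open>X\<close> that the walk
  may have flipped have no influence.\<close>

lemma restrict_local_constraint:
  "(\<forall>x\<in>X. local_constraint \<beta> A (E \<inter> X) x) \<longleftrightarrow> (\<forall>x\<in>X. local_constraint \<beta> A E x)"
  using attacks by (intro ball_cong refl local_constraint_cong) (auto simp: neighbourhood_def)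

lemma violations_empty_iff:
  assumes "\<And>E. E \<subseteq> X \<Longrightarrow> E \<in> \<sigma> (X, A) \<longleftrightarrow> (\<forall>x\<in>X. local_constraint \<beta> A E x)"
  shows "violations \<beta> Xt At E = [] \<longleftrightarrow> ext E \<inter> X \<in> \<sigma> (X, A)"
proof -
  have "violations \<beta> Xt At E = [] \<longleftrightarrow> (\<forall>x\<in>X. local_constraint \<beta> A (ext E) x)"
    using set_violations [of \<beta> E] by (auto simp flip: set_empty)
  then show ?thesis
    using assms [of "ext E \<inter> X"] by (simp add: restrict_local_constraint)
qed

end

section \<open>The four problems\<close>

text \<open>Nonemptiness is not local. It is secured by trying every argument \<open>e\<close> as a
  member: with \<open>e\<close> in the starting set and in the target, every set between them
  contains \<open>e\<close>.\<close>

definition insert_member :: "tree \<Rightarrow> tree \<Rightarrow> tree" where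
  "insert_member S e = (if odd_member S e then S else Node e S)"

definition repairs ::
  "(bool \<Rightarrow> bool \<Rightarrow> bool \<Rightarrow> bool) \<Rightarrow> tree \<Rightarrow> tree \<Rightarrow> tree \<Rightarrow> tree \<Rightarrow> bool" where
  "repairs \<beta> X A S w \<longleftrightarrow> (\<exists>e\<in>set (lst X).
     odd_member (walk \<beta> X A (insert_member S e) w) e \<and>
     \<not> list_tree (violations \<beta> X A (walk \<beta> X A (insert_member S e) w)) \<noteq> Leaf \<and>
     \<not> length (lst w) < length (difference X (walk \<beta> X A (insert_member S e) w) S))"

text \<open>Flipping \<open>x\<close> before the walk makes the start agree with every admissible
  target at \<open>x\<close>, so the walk to such a target leaves \<open>x\<close> flipped.\<close>

definition adjusts ::
  "(bool \<Rightarrow> bool \<Rightarrow> bool \<Rightarrow> bool) \<Rightarrow> tree \<Rightarrow> tree \<Rightarrow> tree \<Rightarrow> tree \<Rightarrow> tree \<Rightarrow> bool" where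
  "adjusts \<beta> X A S x w \<longleftrightarrow>
     \<not> odd_member (walk \<beta> X A (Node x S) w) x = odd_member S x \<and>
     \<not> list_tree (violations \<beta> X A (walk \<beta> X A (Node x S) w)) \<noteq> Leaf \<and>
     \<not> length (lst w) < length (difference X (walk \<beta> X A (Node x S) w) S)"

text \<open>
  The first half of the word tells on which part of the difference of \<open>S\<close> and \<open>S'\<close> the center
  deviates from \<open>S\<close>.
\<close>

definition center_walk ::
  "(bool \<Rightarrow> bool \<Rightarrow> bool \<Rightarrow> bool) \<Rightarrow> tree \<Rightarrow> tree \<Rightarrow> tree \<Rightarrow> tree \<Rightarrow> tree \<Rightarrow> tree" where
  "center_walk \<beta> X A S S' w =
     walk \<beta> X A (right (select (difference X S S') w S)) (left (select (difference X S S') w S))"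

definition centers ::
  "(bool \<Rightarrow> bool \<Rightarrow> bool \<Rightarrow> bool) \<Rightarrow> tree \<Rightarrow> tree \<Rightarrow> tree \<Rightarrow> tree \<Rightarrow> tree \<Rightarrow> bool" where
  "centers \<beta> X A S S' w \<longleftrightarrow>
     \<not> list_tree (violations \<beta> X A (center_walk \<beta> X A S S' w)) \<noteq> Leaf \<and>
     length (difference X (center_walk \<beta> X A S S' w) S) < length (difference X S S') \<and>
     length (difference X (center_walk \<beta> X A S S' w) S') < length (difference X S S')"

lemma polytime_insert_member:
  assumes "polytime S" "polytime e"
  shows "polytime (\<lambda>t. insert_member (S t) (e t))"
  unfolding insert_member_def
  by (intro polytime_search assms)

lemma ext_insert_member: "ext (insert_member S (nat_tree e)) = insert e (ext S)"
proof (cases "e \<in> ext S")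
  case True
  then show ?thesis by (auto simp: insert_member_def ext_def)
next
  case False
  then have "insert_member S (nat_tree e) = Node (nat_tree e) S"
    by (simp add: insert_member_def ext_def)
  with False show ?thesis by auto
qed

lemma ptest_repairs:
  assumes "polytime X" "polytime A" "polytime S" "polytime w"
  shows "ptest (\<lambda>t. repairs \<beta> (X t) (A t) (S t) (w t))"
  unfolding repairs_def
  by (intro polytime_search polytime_insert_member assms [THEN fptime_comp] assms)

lemma ptest_adjusts:
  assumes "polytime X" "polytime A" "polytime S" "polytime x" "polytime w"
  shows "ptest (\<lambda>t. adjusts \<beta> (X t) (A t) (S t) (x t) (w t))"
  unfolding adjusts_def
  by (intro polytime_search assms [THEN fptime_comp] assms)

lemma polytime_center_walk:
  assumes "polytime X" "polytime A" "polytime S" "polytime S'" "polytime w"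
  shows "polytime (\<lambda>t. center_walk \<beta> (X t) (A t) (S t) (S' t) (w t))"
  unfolding center_walk_def
  by (intro polytime_search assms [THEN fptime_comp] assms)

lemma ptest_centers:
  assumes "polytime X" "polytime A" "polytime S" "polytime S'" "polytime w"
  shows "ptest (\<lambda>t. centers \<beta> (X t) (A t) (S t) (S' t) (w t))"
  unfolding centers_def
  by (intro polytime_search polytime_center_walk assms [THEN fptime_comp] assms)

text \<open>\<open>E'\<close> is chosen before \<open>ls\<close>: the word for the subsequent walk
  can only be found once its starting set is known.\<close>

lemma ext_select:
  assumes "distinct ds" "l \<noteq> Leaf"
  shows "\<exists>E'. (\<forall>ls. select (map nat_tree ds) (list_tree (map (\<lambda>d. if d \<in> D then l else Leaf) ds @ ls)) E =
      Node (list_tree ls) E') \<and> ext E' = sym_diff (ext E) (set ds \<inter> D)"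
  using assms(1)
proof (induction ds arbitrary: E)
  case (Cons d ds)
  let ?E = "if d \<in> D then Node (nat_tree d) E else E"
  have "select (map nat_tree (d # ds)) (list_tree (map (\<lambda>d. if d \<in> D then l else Leaf) (d # ds) @ ls)) E =
      select (map nat_tree ds) (list_tree (map (\<lambda>d. if d \<in> D then l else Leaf) ds @ ls)) ?E" for ls
    using assms(2) by (simp add: select_def)
  moreover obtain E' where "\<forall>ls. select (map nat_tree ds)
      (list_tree (map (\<lambda>d. if d \<in> D then l else Leaf) ds @ ls)) ?E = Node (list_tree ls) E'"
      "ext E' = sym_diff (ext ?E) (set ds \<inter> D)"
    using Cons.IH [of ?E] Cons.prems by auto
  moreover have "sym_diff (ext ?E) (set ds \<inter> D) = sym_diff (ext E) (set (d # ds) \<inter> D)"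
    using Cons.prems by auto
  ultimately show ?case by simp
qed (simp add: select_def)

section \<open>Correctness of the three checks\<close>

locale encoded_semantics = encoded_af X A c Xt At
  for X :: "nat set" and A c Xt At +
  fixes \<sigma> :: semantics and \<beta> :: "bool \<Rightarrow> bool \<Rightarrow> bool \<Rightarrow> bool"
  assumes local: "\<And>E. E \<subseteq> X \<Longrightarrow> E \<in> \<sigma> (X, A) \<longleftrightarrow> (\<forall>x\<in>X. local_constraint \<beta> A E x)"
    and extension: "\<And>E. E \<in> \<sigma> (X, A) \<Longrightarrow> E \<subseteq> X"
begin

lemma length_difference_dist:
  assumes "ext S \<subseteq> X"
  shows "length (difference Xt E S) = dist (ext E \<inter> X) (ext S)"
  unfolding length_difference dist_def using assms by (intro arg_cong [of _ _ card]) auto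

lemma solution_iff: "violations \<beta> Xt At E = [] \<longleftrightarrow> ext E \<inter> X \<in> \<sigma> (X, A)"
  by (rule violations_empty_iff) (rule local)

lemma walk_finds:
  assumes "E \<in> \<sigma> (X, A)" "ext S \<subseteq> X" "dist E (ext S) \<le> n"
  obtains ls where "length ls = n" "set ls \<subseteq> set (letters (branching c))"
    "violations \<beta> Xt At (walk \<beta> Xt At S (list_tree ls)) = []"
    "ext S \<inter> E \<subseteq> ext (walk \<beta> Xt At S (list_tree ls))"
    "ext (walk \<beta> Xt At S (list_tree ls)) \<subseteq> ext S \<union> E"
proof -
  have E: "E \<subseteq> X" "\<forall>x\<in>X. local_constraint \<beta> A E x"
    using assms(1) extension local [of E] by blast+
  have "finite (sym_diff (ext S) E)"
    using assms(2) E(1) finite_X by (auto intro: finite_subset)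
  moreover have "card (sym_diff (ext S) E) \<le> n"
    using assms(3) by (simp add: dist_def Un_commute)
  ultimately obtain ls where ls: "length ls = n" "set ls \<subseteq> set (letters (branching c))"
    "\<forall>x\<in>X. local_constraint \<beta> A (ext (walk \<beta> Xt At S (list_tree ls))) x"
    "ext S \<inter> E \<subseteq> ext (walk \<beta> Xt At S (list_tree ls))"
    "ext (walk \<beta> Xt At S (list_tree ls)) \<subseteq> ext S \<union> E"
    using walk_reaches [OF E(2)] by blast
  moreover have "violations \<beta> Xt At (walk \<beta> Xt At S (list_tree ls)) = []"
    using ls(3) set_violations [of \<beta> "walk \<beta> Xt At S (list_tree ls)"] by (auto simp flip: set_empty)
  ultimately show ?thesis using that by blast
qed

text \<open>Where \<open>E'\<close> deviates from \<open>S\<close>, so does \<open>E\<close>. Hence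
  a solution found on the way to \<open>E\<close> passes the distance check whenever
  \<open>E\<close> does.\<close>

lemma dist_between:
  assumes "E \<subseteq> X" "S \<subseteq> X" "S \<inter> E \<subseteq> E'" "E' \<subseteq> S \<union> E"
  shows "dist (E' \<inter> X) S \<le> dist E S"
  unfolding dist_def
  by (rule card_mono) (use assms finite_X in \<open>auto intro: finite_subset\<close>)

text \<open>A given extension yields a word by the walk towards it. Conversely the check inspects
  the final set itself, so any word that passes certifies an extension, no matter how it was
  found.\<close>

lemma repairs_iff:
  assumes "ext St = S" "S \<subseteq> X"
  shows "(\<exists>E\<in>\<sigma> (X, A). E \<noteq> {} \<and> dist E S \<le> k) \<longleftrightarrow>
    (\<exists>ls. length ls = k \<and> set ls \<subseteq> set (letters (branching c)) \<and> repairs \<beta> Xt At St (list_tree ls))"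
proof
  assume "\<exists>E\<in>\<sigma> (X, A). E \<noteq> {} \<and> dist E S \<le> k"
  then obtain E e where E: "E \<in> \<sigma> (X, A)" "e \<in> E" "dist E S \<le> k" by blast
  then have EX: "E \<subseteq> X" using extension by blast
  let ?T = "insert_member St (nat_tree e)"
  have S: "ext ?T = insert e S"
    by (simp add: ext_insert_member assms(1))
  \<comment> \<open>As \<open>e\<close> belongs to \<open>E\<close>, adding it does not lead away
    from \<open>E\<close>, and \<open>k\<close> letters still suffice.\<close>
  have "dist E (insert e S) \<le> dist E S"
    unfolding dist_def by (rule card_mono) (use E EX assms(2) finite_X in \<open>auto intro: finite_subset\<close>)
  with E(3) have k: "dist E (ext ?T) \<le> k" unfolding S by linarith
  have X: "ext ?T \<subseteq> X" unfolding S using E(2) EX assms(2) by blast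
  obtain ls where ls: "length ls = k" "set ls \<subseteq> set (letters (branching c))"
    "violations \<beta> Xt At (walk \<beta> Xt At ?T (list_tree ls)) = []"
    "insert e S \<inter> E \<subseteq> ext (walk \<beta> Xt At ?T (list_tree ls))"
    "ext (walk \<beta> Xt At ?T (list_tree ls)) \<subseteq> insert e S \<union> E"
    by (rule walk_finds [OF E(1) X k, unfolded S])
  let ?E = "walk \<beta> Xt At ?T (list_tree ls)"
  have e: "odd_member ?E (nat_tree e)" using ls(4) E(2) by (auto simp: ext_def)
  have d: "\<not> length ls < length (difference Xt ?E St)"
  proof -
    have "length (difference Xt ?E St) = dist (ext ?E \<inter> X) S"
      by (rule length_difference_dist [of St, unfolded assms(1), OF assms(2)])
    also have "\<dots> \<le> dist E S"
      by (rule dist_between [OF EX assms(2)]) (use ls(4) in blast, use ls(5) E(2) in blast)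
    finally show ?thesis using E(3) ls(1) by simp
  qed
  have "nat_tree e \<in> set (lst Xt)"
  proof -
    obtain xs where "set xs = X" "lst Xt = map nat_tree xs" by (rule lst_Xt)
    then show ?thesis using E(2) EX by auto
  qed
  then have r: "repairs \<beta> Xt At St (list_tree ls)"
    unfolding repairs_def list_tree_eq_Leaf not_not lst_list_tree
    by (rule bexI [rotated]) (intro conjI e ls(3) d)
  show "\<exists>ls. length ls = k \<and> set ls \<subseteq> set (letters (branching c)) \<and> repairs \<beta> Xt At St (list_tree ls)"
    by (rule exI [of _ ls], intro conjI ls(1,2) r)
next
  assume "\<exists>ls. length ls = k \<and> set ls \<subseteq> set (letters (branching c)) \<and> repairs \<beta> Xt At St (list_tree ls)"
  then obtain ls e' where ls: "length ls = k" "e' \<in> set (lst Xt)"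
    "odd_member (walk \<beta> Xt At (insert_member St e') (list_tree ls)) e'"
    "violations \<beta> Xt At (walk \<beta> Xt At (insert_member St e') (list_tree ls)) = []"
    "length (difference Xt (walk \<beta> Xt At (insert_member St e') (list_tree ls)) St) \<le> k"
    unfolding repairs_def list_tree_eq_Leaf not_not not_less lst_list_tree by (elim exE conjE bexE) blast
  obtain xs where "set xs = X" "lst Xt = map nat_tree xs" by (rule lst_Xt)
  with ls(2) obtain e where e: "e' = nat_tree e" "e \<in> X" by auto
  let ?E = "ext (walk \<beta> Xt At (insert_member St e') (list_tree ls)) \<inter> X"
  have "?E \<in> \<sigma> (X, A)" using ls(4) by (simp add: solution_iff)
  moreover have "?E \<noteq> {}"
  proof
    have "e \<in> ?E" using ls(3) e by (simp add: ext_def)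
    also assume "?E = {}"
    finally show False by (rule emptyE)
  qed
  moreover have "dist ?E S \<le> k" using ls(5)
    by (simp only: length_difference_dist [of St, unfolded assms(1), OF assms(2)])
  ultimately show "\<exists>E\<in>\<sigma> (X, A). E \<noteq> {} \<and> dist E S \<le> k"
    by (intro bexI conjI)
qed

lemma adjusts_iff:
  assumes "ext St = S" "S \<subseteq> X" "x \<in> X"
  shows "(\<exists>E\<in>\<sigma> (X, A). dist E S \<le> k \<and> x \<in> sym_diff S E) \<longleftrightarrow>
    (\<exists>ls. length ls = k \<and> set ls \<subseteq> set (letters (branching c)) \<and>
      adjusts \<beta> Xt At St (nat_tree x) (list_tree ls))"
proof
  assume "\<exists>E\<in>\<sigma> (X, A). dist E S \<le> k \<and> x \<in> sym_diff S E"
  then obtain E where E: "E \<in> \<sigma> (X, A)" "dist E S \<le> k" "x \<in> sym_diff S E" by blast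
  then have EX: "E \<subseteq> X" using extension by blast
  let ?S = "Node (nat_tree x) St"
  have S: "ext ?S = sym_diff S {x}"
    using assms(1) by simp
  \<comment> \<open>The flip happens where \<open>S\<close> and \<open>E\<close> differ, so it leads
    towards \<open>E\<close> and \<open>k\<close> letters still suffice.\<close>
  have "dist E (sym_diff S {x}) \<le> dist E S"
    unfolding dist_def by (rule card_mono) (use E EX assms(2) finite_X in \<open>auto intro: finite_subset\<close>)
  with E(2) have k: "dist E (ext ?S) \<le> k" unfolding S by linarith
  have X: "ext ?S \<subseteq> X" unfolding S using assms(2,3) by blast
  obtain ls where ls: "length ls = k" "set ls \<subseteq> set (letters (branching c))"
    "violations \<beta> Xt At (walk \<beta> Xt At ?S (list_tree ls)) = []"
    "sym_diff S {x} \<inter> E \<subseteq> ext (walk \<beta> Xt At ?S (list_tree ls))"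
    "ext (walk \<beta> Xt At ?S (list_tree ls)) \<subseteq> sym_diff S {x} \<union> E"
    by (rule walk_finds [OF E(1) X k, unfolded S])
  let ?E = "walk \<beta> Xt At ?S (list_tree ls)"
  have "x \<in> ext ?E \<longleftrightarrow> x \<notin> S" using ls(4,5) E(3) by auto
  then have "odd_member ?E (nat_tree x) \<noteq> odd_member St (nat_tree x)"
    using assms(1) by (auto simp: ext_def)
  moreover have "length (difference Xt ?E St) \<le> k"
  proof -
    have "length (difference Xt ?E St) = dist (ext ?E \<inter> X) S"
      by (rule length_difference_dist [of St, unfolded assms(1), OF assms(2)])
    also have "\<dots> \<le> dist E S"
      by (rule dist_between) (use EX assms(2) ls(4,5) E(3) in auto)
    finally show ?thesis using E(2) by simp
  qed
  ultimately have "adjusts \<beta> Xt At St (nat_tree x) (list_tree ls)"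
    unfolding adjusts_def using ls(1,3) by auto
  with ls(1,2) show "\<exists>ls. length ls = k \<and> set ls \<subseteq> set (letters (branching c)) \<and>
      adjusts \<beta> Xt At St (nat_tree x) (list_tree ls)" by blast
next
  assume "\<exists>ls. length ls = k \<and> set ls \<subseteq> set (letters (branching c)) \<and>
      adjusts \<beta> Xt At St (nat_tree x) (list_tree ls)"
  then obtain ls where ls: "length ls = k"
    "odd_member (walk \<beta> Xt At (Node (nat_tree x) St) (list_tree ls)) (nat_tree x) \<noteq> odd_member St (nat_tree x)"
    "violations \<beta> Xt At (walk \<beta> Xt At (Node (nat_tree x) St) (list_tree ls)) = []"
    "length (difference Xt (walk \<beta> Xt At (Node (nat_tree x) St) (list_tree ls)) St) \<le> k"
    unfolding adjusts_def list_tree_eq_Leaf not_not not_less lst_list_tree by blast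
  let ?E = "ext (walk \<beta> Xt At (Node (nat_tree x) St) (list_tree ls)) \<inter> X"
  have "?E \<in> \<sigma> (X, A)" using ls(3) by (simp add: solution_iff)
  moreover have "x \<in> sym_diff S ?E" using ls(2) assms(1,3) by (auto simp: ext_def)
  moreover have "dist ?E S \<le> k" using ls(4)
    by (simp only: length_difference_dist [of St, unfolded assms(1), OF assms(2)])
  ultimately show "\<exists>E\<in>\<sigma> (X, A). dist E S \<le> k \<and> x \<in> sym_diff S E" by blast
qed

text \<open>A walk from \<open>S\<close> towards \<open>E\<close> controls the distance to
  \<open>S\<close> but not to \<open>S'\<close>. The start \<open>T\<close> therefore agrees with
  \<open>E\<close> on the difference of \<open>S\<close> and \<open>S'\<close> and with both
  elsewhere. A set between \<open>T\<close> and \<open>E\<close> is then between \<open>S\<close>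
  and \<open>E\<close> and also between \<open>S'\<close> and \<open>E\<close>, so both distances
  are controlled.\<close>

lemma centers_iff:
  assumes "ext St = S" "S \<subseteq> X" "ext St' = S'" "S' \<subseteq> X"
  shows "(\<exists>E\<in>\<sigma> (X, A). dist E S < dist S S' \<and> dist E S' < dist S S') \<longleftrightarrow>
    (\<exists>ls. length ls = 2 * dist S S' \<and> set ls \<subseteq> set (letters (branching c)) \<and>
      centers \<beta> Xt At St St' (list_tree ls))"
proof
  have D: "length (difference Xt St St') = dist S S'"
    using length_difference_dist [of St' St] assms by (simp add: Int_absorb2)
  {
    assume "\<exists>E\<in>\<sigma> (X, A). dist E S < dist S S' \<and> dist E S' < dist S S'"
    then obtain E where E: "E \<in> \<sigma> (X, A)" "dist E S < dist S S'" "dist E S' < dist S S'" by blast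
    then have EX: "E \<subseteq> X" using extension by blast
    obtain ds where ds: "distinct ds" "set ds = sym_diff S S'" "difference Xt St St' = map nat_tree ds"
    proof -
      obtain xs where xs: "distinct xs" "set xs = X" "lst Xt = map nat_tree xs" by (rule lst_Xt)
      show ?thesis
        by (rule that [of "filter (\<lambda>x. (x \<in> S) \<noteq> (x \<in> S')) xs"])
          (use xs assms in \<open>auto simp: difference_def filter_map comp_def ext_def\<close>)
    qed
    \<comment> \<open>In the first half of the word the letter 1, which is not \<open>Leaf\<close>,
      means flip, and the letter 0, which is \<open>Leaf\<close>, means keep.\<close>
    let ?l = "list_tree (replicate 1 Leaf)" and ?D = "sym_diff S E"
    let ?w = "map (\<lambda>d. if d \<in> ?D then ?l else Leaf) ds"
    obtain T where T: "\<And>ls. select (difference Xt St St') (list_tree (?w @ ls)) St = Node (list_tree ls) T"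
      "ext T = sym_diff S (sym_diff S S' \<inter> ?D)"
      using ext_select [OF ds(1), of ?l ?D St] unfolding ds(2,3) assms(1) by auto
    \<comment> \<open>Passing from \<open>S\<close> to \<open>T\<close> only flips elements where
      \<open>S\<close> and \<open>E\<close> differ, so \<open>dist S S'\<close> letters suffice for
      the second half.\<close>
    have "dist E (ext T) \<le> dist E S"
      unfolding T(2) dist_def by (rule card_mono) (use E EX assms finite_X in \<open>auto intro: finite_subset\<close>)
    then have d: "dist E (ext T) \<le> dist S S'" using E(2) by simp
    have X: "ext T \<subseteq> X" using assms EX unfolding T(2) by auto
    obtain ls where ls: "length ls = dist S S'" "set ls \<subseteq> set (letters (branching c))"
      "violations \<beta> Xt At (walk \<beta> Xt At T (list_tree ls)) = []"
      "ext T \<inter> E \<subseteq> ext (walk \<beta> Xt At T (list_tree ls))"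
      "ext (walk \<beta> Xt At T (list_tree ls)) \<subseteq> ext T \<union> E"
      by (rule walk_finds [OF E(1) X d])
    let ?E = "walk \<beta> Xt At T (list_tree ls)"
    have c: "center_walk \<beta> Xt At St St' (list_tree (?w @ ls)) = ?E"
      unfolding center_walk_def T(1) by simp
    have "dist (ext ?E \<inter> X) S \<le> dist E S"
      by (rule dist_between) (use EX assms(2) ls(4,5) in \<open>auto simp: T(2)\<close>)
    moreover have "dist (ext ?E \<inter> X) S' \<le> dist E S'"
      by (rule dist_between) (use EX assms(4) ls(4,5) in \<open>auto simp: T(2)\<close>)
    ultimately have "centers \<beta> Xt At St St' (list_tree (?w @ ls))"
      unfolding centers_def c D
      using length_difference_dist [of St ?E] length_difference_dist [of St' ?E] ls(3) E assms by simp
    moreover have "length (?w @ ls) = 2 * dist S S'"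
      using ls(1) D ds(3) by simp
    moreover have "set (?w @ ls) \<subseteq> set (letters (branching c))"
      using ls(2) list_tree_replicate_letters [of 0 "branching c"] list_tree_replicate_letters [of 1 "branching c"]
      by (auto simp: branching_def)
    ultimately show "\<exists>ls. length ls = 2 * dist S S' \<and> set ls \<subseteq> set (letters (branching c)) \<and>
      centers \<beta> Xt At St St' (list_tree ls)" by blast
  }
  {
    assume "\<exists>ls. length ls = 2 * dist S S' \<and> set ls \<subseteq> set (letters (branching c)) \<and>
      centers \<beta> Xt At St St' (list_tree ls)"
    then obtain ls where ls: "centers \<beta> Xt At St St' (list_tree ls)" by blast
    let ?E = "center_walk \<beta> Xt At St St' (list_tree ls)"
    have "ext ?E \<inter> X \<in> \<sigma> (X, A)" using ls by (simp add: solution_iff centers_def)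
    moreover have "dist (ext ?E \<inter> X) S < dist S S'" "dist (ext ?E \<inter> X) S' < dist S S'"
      using ls length_difference_dist [of St ?E] length_difference_dist [of St' ?E] assms
      unfolding centers_def D by simp_all
    ultimately show "\<exists>E\<in>\<sigma> (X, A). dist E S < dist S S' \<and> dist E S' < dist S S'" by blast
  }
qed

end

text \<open>\<beta> depends on \<sigma> alone and precedes the framework, so that one program serves
  all instances.\<close>

lemma encoded_semanticsI:
  assumes "\<sigma> \<in> {adm, com, stb}"
  obtains \<beta> where "\<And>X A c Xt At. is_af (X, A) \<Longrightarrow> max_degree (X, A) \<le> c \<Longrightarrow>
    Node Xt At \<in> enc_af (X, A) \<Longrightarrow> encoded_semantics X A c Xt At \<sigma> \<beta>"
proof -
  obtain \<beta> where \<beta>: "\<And>X A E. is_af (X, A) \<Longrightarrow> E \<subseteq> X \<Longrightarrow>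
    E \<in> \<sigma> (X, A) \<longleftrightarrow> (\<forall>x\<in>X. local_constraint \<beta> A E x)"
    using extensions_local [OF assms] by blast
  show ?thesis
  proof (rule that [of \<beta>])
    fix X A c Xt At
    assume "is_af (X, A)" "max_degree (X, A) \<le> c" "Node Xt At \<in> enc_af (X, A)"
    then show "encoded_semantics X A c Xt At \<sigma> \<beta>"
      using \<beta> extensions_subset [OF assms, of _ "(X, A)"]
      by (intro encoded_semantics.intro encoded_af.intro encoded_semantics_axioms.intro) simp_all
  qed
qed

lemma enc_af_E:
  assumes "t \<in> enc_af (X, A)"
  obtains Xt At where "t = Node Xt At"
  using assms by (auto simp: enc_af_def enc_pair_def)

text \<open>The first summand of the weight, the number of digits, pays for the conversion; the
  second, the value, pays for listing the words of that length. Each is at most the parameter,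
  whence the factor 2 in \<open>unary_bound\<close>.\<close>

lemma fptime_unary_comp:
  assumes "polytime f"
  shows "fptime (\<lambda>t. length (lst (f t)) + bits_val (bits (f t))) (\<lambda>t. unary (f t))"
  by (rule fptime_comp' [OF fptime_mono [OF assms] fptime_unary]) simp_all

lemma unary_bound: "length (lst (nat_tree k)) + bits_val (bits (nat_tree k)) \<le> 2 * k"
  using length_lst_nat_tree [of k] by simp

lemma fixed_parameter_tractable_Repair:
  assumes \<sigma>: "\<sigma> \<in> {adm, com, stb}"
  shows "fixed_parameter_tractable (restrict_degree c (Repair \<sigma>))"
proof -
  obtain \<beta> where \<beta>: "\<And>X A c Xt At. is_af (X, A) \<Longrightarrow> max_degree (X, A) \<le> c \<Longrightarrow>
    Node Xt At \<in> enc_af (X, A) \<Longrightarrow> encoded_semantics X A c Xt At \<sigma> \<beta>"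
    using encoded_semanticsI [OF \<sigma>] by blast
  let ?k = "\<lambda>t. right (right t)"
  let ?chk = "\<lambda>t. repairs \<beta> (left (left t)) (right (left t)) (left (right t))"
  have k: "polytime ?k" by (intro polytime_basic)
  show ?thesis
  proof (rule fixed_parameter_tractable_guess [OF fptime_unary_comp [OF k], where chk = ?chk and a = 2])
    show "ptest (\<lambda>u. ?chk (left u) (right u))"
      by (intro ptest_repairs polytime_basic)
    fix i t assume i: "is_instance (restrict_degree c (Repair \<sigma>)) i"
      and t: "t \<in> encodings (restrict_degree c (Repair \<sigma>)) i"
    obtain X A S k where [simp]: "i = ((X, A), S, k)" by (metis surj_pair)
    obtain Ft St where t': "t = Node Ft (Node St (nat_tree k))"
      and inst: "Ft \<in> enc_af (X, A)" "St \<in> enc_set enc_nat S"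
      using t by (auto simp: restrict_degree_def Repair_def enc_pair_def [of enc_af] enc_pair_def [of "enc_set _"]
        enc_nat_def [of k])
    obtain Xt At where Ft [simp]: "Ft = Node Xt At" using inst(1) by (rule enc_af_E)
    note [simp] = t'
    have wf: "is_af (X, A)" "max_degree (X, A) \<le> c" "S \<subseteq> X"
      using i by (auto simp: restrict_degree_def Repair_def)
    interpret encoded_semantics X A c Xt At \<sigma> \<beta> using wf(1,2) inst(1) unfolding Ft by (rule \<beta>)
    show "length (lst (?k t)) + bits_val (bits (?k t)) \<le> 2 * parameter (restrict_degree c (Repair \<sigma>)) i"
      using unary_bound [of k] by (simp add: restrict_degree_def Repair_def)
    show "answer (restrict_degree c (Repair \<sigma>)) i \<longleftrightarrow> (\<exists>ls. length ls = length (lst (unary (?k t))) \<and>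
        set ls \<subseteq> set (letters (branching c)) \<and> ?chk t (list_tree ls))"
      using repairs_iff [OF ext_enc_set [OF inst(2)] wf(3), of k]
      by (simp add: restrict_degree_def Repair_def)
  qed (simp add: length_unary)
qed

text \<open>The case of Repair in which the given set is empty: \<open>Leaf\<close> encodes it, and
  the distance to it is the cardinality.\<close>

lemma fixed_parameter_tractable_Small:
  assumes \<sigma>: "\<sigma> \<in> {adm, com, stb}"
  shows "fixed_parameter_tractable (restrict_degree c (Small \<sigma>))"
proof -
  obtain \<beta> where \<beta>: "\<And>X A c Xt At. is_af (X, A) \<Longrightarrow> max_degree (X, A) \<le> c \<Longrightarrow>
    Node Xt At \<in> enc_af (X, A) \<Longrightarrow> encoded_semantics X A c Xt At \<sigma> \<beta>"
    using encoded_semanticsI [OF \<sigma>] by blast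
  let ?chk = "\<lambda>t. repairs \<beta> (left (left t)) (right (left t)) Leaf"
  have k: "polytime right" by (rule fptime_right [OF fptime_id])
  show ?thesis
  proof (rule fixed_parameter_tractable_guess [OF fptime_unary_comp [OF k], where chk = ?chk and a = 2])
    show "ptest (\<lambda>u. ?chk (left u) (right u))"
      by (intro ptest_repairs polytime_basic)
    fix i t assume i: "is_instance (restrict_degree c (Small \<sigma>)) i"
      and t: "t \<in> encodings (restrict_degree c (Small \<sigma>)) i"
    obtain X A k where [simp]: "i = ((X, A), k)" by (metis surj_pair)
    obtain Ft where t': "t = Node Ft (nat_tree k)"
      and inst: "Ft \<in> enc_af (X, A)"
      using t by (auto simp: restrict_degree_def Small_def enc_pair_def [of enc_af] enc_nat_def [of k])
    obtain Xt At where Ft [simp]: "Ft = Node Xt At" using inst by (rule enc_af_E)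
    note [simp] = t'
    have wf: "is_af (X, A)" "max_degree (X, A) \<le> c"
      using i by (auto simp: restrict_degree_def Small_def)
    interpret encoded_semantics X A c Xt At \<sigma> \<beta> using wf inst unfolding Ft by (rule \<beta>)
    show "length (lst (right t)) + bits_val (bits (right t)) \<le> 2 * parameter (restrict_degree c (Small \<sigma>)) i"
      using unary_bound [of k] by (simp add: restrict_degree_def Small_def)
    show "answer (restrict_degree c (Small \<sigma>)) i \<longleftrightarrow> (\<exists>ls. length ls = length (lst (unary (right t))) \<and>
        set ls \<subseteq> set (letters (branching c)) \<and> ?chk t (list_tree ls))"
      using repairs_iff [OF ext_Leaf, of k]
      by (simp add: restrict_degree_def Small_def dist_def)
  qed (simp add: length_unary)
qed

lemma fixed_parameter_tractable_Adjust:
  assumes \<sigma>: "\<sigma> \<in> {adm, com, stb}"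
  shows "fixed_parameter_tractable (restrict_degree c (Adjust \<sigma>))"
proof -
  obtain \<beta> where \<beta>: "\<And>X A c Xt At. is_af (X, A) \<Longrightarrow> max_degree (X, A) \<le> c \<Longrightarrow>
    Node Xt At \<in> enc_af (X, A) \<Longrightarrow> encoded_semantics X A c Xt At \<sigma> \<beta>"
    using encoded_semanticsI [OF \<sigma>] by blast
  let ?k = "\<lambda>t. right (right (right t))"
  let ?chk = "\<lambda>t. adjusts \<beta> (left (left t)) (right (left t)) (left (right t)) (left (right (right t)))"
  have k: "polytime ?k" by (intro polytime_basic)
  show ?thesis
  proof (rule fixed_parameter_tractable_guess [OF fptime_unary_comp [OF k], where chk = ?chk and a = 2])
    show "ptest (\<lambda>u. ?chk (left u) (right u))"
      by (intro ptest_adjusts polytime_basic)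
    fix i t assume i: "is_instance (restrict_degree c (Adjust \<sigma>)) i"
      and t: "t \<in> encodings (restrict_degree c (Adjust \<sigma>)) i"
    obtain X A S x k where [simp]: "i = ((X, A), S, x, k)" by (metis surj_pair)
    obtain Ft St where t': "t = Node Ft (Node St (Node (nat_tree x) (nat_tree k)))"
      and inst: "Ft \<in> enc_af (X, A)" "St \<in> enc_set enc_nat S"
      using t by (auto simp: restrict_degree_def Adjust_def enc_pair_def [of enc_af] enc_pair_def [of "enc_set _"]
        enc_pair_def [of enc_nat enc_nat] enc_nat_def [of k] enc_nat_def [of x])
    obtain Xt At where Ft [simp]: "Ft = Node Xt At" using inst(1) by (rule enc_af_E)
    note [simp] = t'
    have wf: "is_af (X, A)" "max_degree (X, A) \<le> c" "S \<in> \<sigma> (X, A)" "x \<in> X"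
      using i by (auto simp: restrict_degree_def Adjust_def)
    interpret encoded_semantics X A c Xt At \<sigma> \<beta> using wf(1,2) inst(1) unfolding Ft by (rule \<beta>)
    show "length (lst (?k t)) + bits_val (bits (?k t)) \<le> 2 * parameter (restrict_degree c (Adjust \<sigma>)) i"
      using unary_bound [of k] by (simp add: restrict_degree_def Adjust_def)
    show "answer (restrict_degree c (Adjust \<sigma>)) i \<longleftrightarrow> (\<exists>ls. length ls = length (lst (unary (?k t))) \<and>
        set ls \<subseteq> set (letters (branching c)) \<and> ?chk t (list_tree ls))"
      using adjusts_iff [OF ext_enc_set [OF inst(2)] extension [OF wf(3)] wf(4), of k]
      by (simp add: restrict_degree_def Adjust_def)
  qed (simp add: length_unary)
qed

text \<open>The parameter is not part of the input. The difference list, computed in polynomial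
  time, already represents it in unary, and two copies of it give the length of the words.\<close>

lemma fixed_parameter_tractable_Center:
  assumes \<sigma>: "\<sigma> \<in> {adm, com, stb}"
  shows "fixed_parameter_tractable (restrict_degree c (Center \<sigma>))"
proof -
  obtain \<beta> where \<beta>: "\<And>X A c Xt At. is_af (X, A) \<Longrightarrow> max_degree (X, A) \<le> c \<Longrightarrow>
    Node Xt At \<in> enc_af (X, A) \<Longrightarrow> encoded_semantics X A c Xt At \<sigma> \<beta>"
    using encoded_semanticsI [OF \<sigma>] by blast
  let ?D = "\<lambda>t. difference (left (left t)) (left (right t)) (right (right t))"
  let ?U = "\<lambda>t. list_tree (?D t @ ?D t)" and ?\<kappa> = "\<lambda>t. length (?D t @ ?D t)"
  let ?chk = "\<lambda>t. centers \<beta> (left (left t)) (right (left t)) (left (right t)) (right (right t))"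
  have "polytime ?U" by (intro polytime_search)
  then have U: "fptime ?\<kappa> ?U" by (rule fptime_mono) simp
  show ?thesis
  proof (rule fixed_parameter_tractable_guess [OF U, where chk = ?chk and a = 2])
    show "ptest (\<lambda>u. ?chk (left u) (right u))"
      by (intro ptest_centers polytime_basic)
    fix i t assume i: "is_instance (restrict_degree c (Center \<sigma>)) i"
      and t: "t \<in> encodings (restrict_degree c (Center \<sigma>)) i"
    obtain X A S S' where [simp]: "i = ((X, A), S, S')" by (metis surj_pair)
    obtain Ft St St' where t': "t = Node Ft (Node St St')"
      and inst: "Ft \<in> enc_af (X, A)" "St \<in> enc_set enc_nat S" "St' \<in> enc_set enc_nat S'"
      using t by (auto simp: restrict_degree_def Center_def enc_pair_def [of enc_af] enc_pair_def [of "enc_set _"])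
    obtain Xt At where Ft [simp]: "Ft = Node Xt At" using inst(1) by (rule enc_af_E)
    note [simp] = t'
    have wf: "is_af (X, A)" "max_degree (X, A) \<le> c" "S \<in> \<sigma> (X, A)" "S' \<in> \<sigma> (X, A)"
      using i by (auto simp: restrict_degree_def Center_def)
    interpret encoded_semantics X A c Xt At \<sigma> \<beta> using wf(1,2) inst(1) unfolding Ft by (rule \<beta>)
    note S = ext_enc_set [OF inst(2)] extension [OF wf(3)] ext_enc_set [OF inst(3)] extension [OF wf(4)]
    have len: "length (?D t) = dist S S'"
      using length_difference_dist [of St' St] S by (simp add: Int_absorb2)
    then show "length (?D t @ ?D t) \<le> 2 * parameter (restrict_degree c (Center \<sigma>)) i"
      by (simp add: restrict_degree_def Center_def)
    show "answer (restrict_degree c (Center \<sigma>)) i \<longleftrightarrow> (\<exists>ls. length ls = length (lst (?U t)) \<and>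
        set ls \<subseteq> set (letters (branching c)) \<and> ?chk t (list_tree ls))"
      using centers_iff [OF S] len by (simp add: restrict_degree_def Center_def mult_2)
  qed simp
qed

theorem theorem3:
  fixes \<sigma> :: semantics and c :: nat
  assumes "\<sigma> \<in> {adm, com, stb}"
  shows "fixed_parameter_tractable (restrict_degree c (Small \<sigma>)) \<and>
         fixed_parameter_tractable (restrict_degree c (Repair \<sigma>)) \<and>
         fixed_parameter_tractable (restrict_degree c (Adjust \<sigma>)) \<and>
         fixed_parameter_tractable (restrict_degree c (Center \<sigma>))"
  using fixed_parameter_tractable_Small [OF assms] fixed_parameter_tractable_Repair [OF assms]
    fixed_parameter_tractable_Adjust [OF assms] fixed_parameter_tractable_Center [OF assms]
  by blast

end
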